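(* Let $P$ be a finite TAOS and let $Q=(Q_0,Q_1,s,t)$ be its Hasse quiver. Suppose $Q$ satisfies one of the following: (i) $Q$ is the Hasse quiver of an array TAOS; (ii) every algebraically connected component of $Q$ is the Hasse quiver of some array TAOS, and for any two distinct algebraically connected components $Q^i$ and $Q^j$ of $Q$ there do not exist paths $p_i$ in $Q^i$ and $p_j$ in $Q^j$, both of length at least two, such that $s(p_i)=s(p_j)$ and $t(p_i)=t(p_j)$. Let $Q'$ be the quiver $Q$ with some extra multiple arrows, i.e. a (finite) quiver with $Q'_0=Q_0$, $Q'_1=Q_1\sqcup E$, such that for every arrow $\alpha_1\in E$ there exists an arrow $\alpha_2\in Q_1$ with $s(\alpha_1)=s(\alpha_2)$ and $t(\alpha_1)=t(\alpha_2)$. Let $I$ be the ideal of $\mathfrak{n}_{Q'}$ generated by all differences $\omega_1-\omega_2$ of two paths $\omega_1,\omega_2$ in $Q'$ of length at least two that start at the same vertex and end at the same vertex. Then there exists an inner product $\langle\cdot,\cdot\rangle$ on $\mathfrak{n}_{Q'}/I$ such that $(\mathfrak{n}_{Q'}/I,\langle\cdot,\cdot\rangle)$ is an algebraic Ricci soliton with respect to $-1$, i.e. $\mathrm{Ric}=-\mathrm{id}+D$ for some $D\in\mathrm{Der}(\mathfrak{n}_{Q'}/I)$.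
   Context: A quiver is a quadruple $(Q_0,Q_1,s,t)$ with finite vertex set $Q_0$, finite arrow set $Q_1$, and maps $s,t:Q_1\to Q_0$ (start and terminal vertex); all quivers are finite and acyclic. For a path $p$, $s(p)$ and $t(p)$ are its starting and terminal vertices; its length is its number of arrows. A transitively and antisymmetrically ordered set (TAOS) is a set $P$ with a binary relation $\prec$ that is transitive and antisymmetric ($s\prec t$, $t\prec s$ imply $s=t$); it need be neither reflexive nor irreflexive. Hasse quiver of a TAOS $P$: the quiver with vertex set $P$ and with exactly one arrow from $a$ to $b$ whenever $a\prec b$, $a\neq b$, and there is no $t\in P\setminus\{a,b\}$ with $a\prec t\prec b$ (no other arrows). Path algebra: for a finite acyclic quiver $Q$, $\mathfrak{n}_Q$ is the real associative algebra with basis all paths of length $\ge 1$ in $Q$, with product given by concatenation of paths ($xy$ if $xy$ is a path, and $0$ otherwise). It, and its quotient by a two-sided ideal, are regarded as Lie algebras with $[x,y]=x\cdot y-y\cdot x$. Algebraic connectivity: a finite quiver $Q$ is algebraically connected if $\mathfrak{n}_Q$ is not isomorphic, as an associative algebra, to a direct sum of more than one (nonzero) path algebra of a quiver. In general $\mathfrak{n}_Q=\bigoplus_{i=1}^n \mathfrak{n}_{E_i}$ where the $E_i$ are algebraically connected subquivers of $Q$ (each having at least one arrow and no isolated vertices; the direct sum is internal, so the arrow sets of the $E_i$ partition the arrow set of $Q$, while different $E_i$ may share vertices). The $E_i$ are the algebraically connected components of $Q$. Array TAOS: given integers $k\ge 2$, $n_1,\dots,n_k\ge 1$, and $m_1,\dots,m_k$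 with $1\le m_i\le n_i$, $m_1=n_1$, $m_k=n_k$, let $P$ be a set with $\sum_{i=1}^k n_i$ elements partitioned into $k$ columns, the $i$-th column having $n_i$ elements. For each $i=1,\dots,k-1$ choose $m_{i+1}$ elements of the $(i+1)$-th column and declare $\eta_i\prec\eta_{i+1}$ for each element $\eta_i$ of the $i$-th column and each of the $m_{i+1}$ chosen elements $\eta_{i+1}$ of the $(i+1)$-th column. The relation $\prec$ on $P$ is the transitive closure of these relations. Curvature of a metric Lie algebra $(\mathfrak g,\langle\cdot,\cdot\rangle)$ (a finite-dimensional real Lie algebra with inner product): the Levi-Civita connection $\nabla$ is defined by $2\langle\nabla_XY,Z\rangle=\langle[X,Y],Z\rangle+\langle[Z,X],Y\rangle+\langle X,[Z,Y]\rangle$; $R(X,Y)Z=\nabla_X\nabla_YZ-\nabla_Y\nabla_XZ-\nabla_{[X,Y]}Z$; and $\mathrm{Ric}(X)=\sum_i R(X,e_i)e_i$ for an orthonormal basis $\{e_i\}$. $\mathrm{Der}(\mathfrak g)$ is the set of derivations. $(\mathfrak g,\langle\cdot,\cdot\rangle)$ is an algebraic Ricci soliton with respect to $c\in\mathbb{R}$ if $\mathrm{Ric}=c\cdot\mathrm{id}+D$ for some $D\in\mathrm{Der}(\mathfrak g)$. *)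

theory Defs
  imports
    "Graph_Theory.Graph_Theory"
    "Jordan_Normal_Form.VS_Connect"
    "HOL-Algebra.QuotRing"
    "HOL-Library.Disjoint_Sets"
begin

section \<open>Quivers, Hasse quivers and array TAOS\<close>

definition quiver :: "('v, 'e) pre_digraph \<Rightarrow> bool" where
  "quiver Q \<longleftrightarrow> fin_digraph Q \<and> acyclic (arcs_ends Q)"

definition taos :: "'v set \<Rightarrow> ('v \<Rightarrow> 'v \<Rightarrow> bool) \<Rightarrow> bool" where
  "taos P r \<longleftrightarrow> transp_on P r \<and> antisymp_on P r"

text \<open>The arrows may be of any type: being the Hasse quiver of \<open>(P, r)\<close> only means that there is
  exactly one arrow for each of the listed pairs of vertices and no other arrow.\<close>

definition hasse_quiver :: "'v set \<Rightarrow> ('v \<Rightarrow> 'v \<Rightarrow> bool) \<Rightarrow> ('v, 'e) pre_digraph \<Rightarrow> bool" where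
  "hasse_quiver P r Q \<longleftrightarrow>
     nomulti_digraph Q \<and> verts Q = P \<and>
     arcs_ends Q = {(a, b). a \<in> P \<and> b \<in> P \<and> r a b \<and> a \<noteq> b \<and> \<not> (\<exists>t\<in>P - {a, b}. r a t \<and> r t b)}"

text \<open>\<open>C i\<close> is the \<open>i\<close>-th column, and \<open>S i\<close> (for \<open>2 \<le> i \<le> k\<close>) the set of chosen
  elements of the \<open>i\<close>-th column.\<close>

definition array_taos :: "'v set \<Rightarrow> ('v \<Rightarrow> 'v \<Rightarrow> bool) \<Rightarrow> bool" where
  "array_taos P r \<longleftrightarrow>
     (\<exists>(k::nat) (n::nat \<Rightarrow> nat) (m::nat \<Rightarrow> nat) (C::nat \<Rightarrow> 'v set) (S::nat \<Rightarrow> 'v set).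
        k \<ge> 2 \<and> (\<forall>i\<in>{1..k}. 1 \<le> n i \<and> 1 \<le> m i \<and> m i \<le> n i) \<and> m 1 = n 1 \<and> m k = n k \<and>
        P = (\<Union>i\<in>{1..k}. C i) \<and> disjoint_family_on C {1..k} \<and> (\<forall>i\<in>{1..k}. card (C i) = n i) \<and>
        (\<forall>i\<in>{1..<k}. S (i + 1) \<subseteq> C (i + 1) \<and> card (S (i + 1)) = m (i + 1)) \<and>
        r = tranclp (\<lambda>a b. \<exists>i\<in>{1..<k}. a \<in> C i \<and> b \<in> S (i + 1)))"


section \<open>Real algebras\<close>

text \<open>Real algebras are \<open>module\<close> records over the field \<open>class_ring\<close> of real numbers. The algebras
  considered here have no unit, and their field \<open>one\<close> is a dummy that is never used.\<close>

definition algebra_ideal :: "(real, 'a) module \<Rightarrow> 'a set \<Rightarrow> bool" where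
  "algebra_ideal A J \<longleftrightarrow>
     Module.submodule J class_ring A \<and>
     (\<forall>a\<in>carrier A. \<forall>x\<in>J. a \<otimes>\<^bsub>A\<^esub> x \<in> J \<and> x \<otimes>\<^bsub>A\<^esub> a \<in> J)"

definition quotient_algebra :: "(real, 'a) module \<Rightarrow> 'a set \<Rightarrow> (real, 'a set) module" where
  "quotient_algebra A J =
     \<lparr>carrier = a_rcosets\<^bsub>A\<^esub> J, monoid.mult = rcoset_mult A J, one = undefined,
      zero = J, add = set_add A, smult = (\<lambda>c X. \<Union>x\<in>X. J +>\<^bsub>A\<^esub> (c \<odot>\<^bsub>A\<^esub> x))\<rparr>"

definition algebra_iso :: "(real, 'a) module \<Rightarrow> (real, 'b) module \<Rightarrow> bool" where
  "algebra_iso A B \<longleftrightarrow>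
     (\<exists>f \<in> module_hom class_ring A B. bij_betw f (carrier A) (carrier B) \<and>
        (\<forall>x\<in>carrier A. \<forall>y\<in>carrier A. f (x \<otimes>\<^bsub>A\<^esub> y) = f x \<otimes>\<^bsub>B\<^esub> f y))"

definition direct_sum_algebra :: "nat \<Rightarrow> (nat \<Rightarrow> (real, 'a) module) \<Rightarrow> (real, nat \<Rightarrow> 'a) module" where
  "direct_sum_algebra n A =
     \<lparr>carrier = (\<Pi>\<^sub>E i\<in>{..<n}. carrier (A i)),
      monoid.mult = (\<lambda>x y. \<lambda>i\<in>{..<n}. x i \<otimes>\<^bsub>A i\<^esub> y i), one = undefined,
      zero = (\<lambda>i\<in>{..<n}. \<zero>\<^bsub>A i\<^esub>), add = (\<lambda>x y. \<lambda>i\<in>{..<n}. x i \<oplus>\<^bsub>A i\<^esub> y i),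
      smult = (\<lambda>c x. \<lambda>i\<in>{..<n}. c \<odot>\<^bsub>A i\<^esub> x i)\<rparr>"


section \<open>Path algebras\<close>

text \<open>A path of positive length is the nonempty list of its arrows.\<close>

definition paths :: "('v, 'e) pre_digraph \<Rightarrow> 'e list set" where
  "paths Q = {p. p \<noteq> [] \<and> (\<exists>u v. pre_digraph.awalk Q u p v)}"

text \<open>Elements are formal linear combinations of paths, given by their coefficient functions.\<close>

definition path_algebra :: "('v, 'e) pre_digraph \<Rightarrow> (real, 'e list \<Rightarrow> real) module" where
  "path_algebra Q =
     \<lparr>carrier = {x. finite {p. x p \<noteq> 0} \<and> {p. x p \<noteq> 0} \<subseteq> paths Q},
      monoid.mult = (\<lambda>x y r. if r \<in> paths Q
         then \<Sum>(p, q) \<in> {(p, q). p \<in> paths Q \<and> q \<in> paths Q \<and> p @ q = r}. x p * y q else 0),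
      one = undefined,
      zero = (\<lambda>p. 0), add = (\<lambda>x y p. x p + y p), smult = (\<lambda>c x p. c * x p)\<rparr>"

definition path_vector :: "'e list \<Rightarrow> 'e list \<Rightarrow> real" where
  "path_vector w = (\<lambda>p. if p = w then 1 else 0)"

definition parallel_path_ideal :: "('v, 'e) pre_digraph \<Rightarrow> ('e list \<Rightarrow> real) set" where
  "parallel_path_ideal Q =
     algebra_ideal (path_algebra Q) hull
       {path_vector w1 \<ominus>\<^bsub>path_algebra Q\<^esub> path_vector w2 | w1 w2 u v.
          pre_digraph.awalk Q u w1 v \<and> pre_digraph.awalk Q u w2 v \<and> length w1 \<ge> 2 \<and> length w2 \<ge> 2}"

text \<open>Every finite quiver is isomorphic to one whose vertices and arrows are natural numbers, so it
  suffices to let the summands range over those.\<close>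

definition algebraically_connected :: "('v, 'e) pre_digraph \<Rightarrow> bool" where
  "algebraically_connected Q \<longleftrightarrow>
     \<not> (\<exists>n\<ge>2. \<exists>E :: nat \<Rightarrow> (nat, nat) pre_digraph.
          (\<forall>i<n. quiver (E i) \<and> carrier (path_algebra (E i)) \<noteq> {\<zero>\<^bsub>path_algebra (E i)\<^esub>}) \<and>
          algebra_iso (path_algebra Q) (direct_sum_algebra n (\<lambda>i. path_algebra (E i))))"

text \<open>The last two conjuncts say that the path algebra of \<open>Q\<close> is the internal direct sum of its
  subalgebras \<open>path_algebra E\<close>, for \<open>E \<in> Es\<close>.\<close>

definition algebraically_connected_components ::
    "('v, 'e) pre_digraph \<Rightarrow> ('v, 'e) pre_digraph set \<Rightarrow> bool" where
  "algebraically_connected_components Q Es \<longleftrightarrow>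
     finite Es \<and>
     (\<forall>E\<in>Es. subgraph E Q \<and> algebraically_connected E \<and> arcs E \<noteq> {} \<and>
        (\<forall>v\<in>verts E. \<exists>e\<in>arcs E. tail E e = v \<or> head E e = v)) \<and>
     (\<forall>x\<in>carrier (path_algebra Q). \<exists>!f. f \<in> (\<Pi>\<^sub>E E\<in>Es. carrier (path_algebra E)) \<and>
        x = (\<Oplus>\<^bsub>path_algebra Q\<^esub>E\<in>Es. f E)) \<and>
     (\<forall>E\<in>Es. \<forall>F\<in>Es. E \<noteq> F \<longrightarrow>
        (\<forall>x\<in>carrier (path_algebra E). \<forall>y\<in>carrier (path_algebra F).
           x \<otimes>\<^bsub>path_algebra Q\<^esub> y = \<zero>\<^bsub>path_algebra Q\<^esub>))"


section \<open>Metric Lie algebras\<close>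

text \<open>A Lie algebra is a \<open>module\<close> record over \<open>class_ring\<close> whose multiplication is the bracket.\<close>

definition commutator_lie_algebra :: "(real, 'a) module \<Rightarrow> (real, 'a) module" where
  "commutator_lie_algebra A = A\<lparr>monoid.mult := \<lambda>x y. (x \<otimes>\<^bsub>A\<^esub> y) \<ominus>\<^bsub>A\<^esub> (y \<otimes>\<^bsub>A\<^esub> x)\<rparr>"

definition real_lie_algebra :: "(real, 'a) module \<Rightarrow> bool" where
  "real_lie_algebra L \<longleftrightarrow>
     vectorspace class_ring L \<and>
     (\<forall>x\<in>carrier L. (\<lambda>y. x \<otimes>\<^bsub>L\<^esub> y) \<in> module_hom class_ring L L) \<and>
     (\<forall>y\<in>carrier L. (\<lambda>x. x \<otimes>\<^bsub>L\<^esub> y) \<in> module_hom class_ring L L) \<and>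
     (\<forall>x\<in>carrier L. x \<otimes>\<^bsub>L\<^esub> x = \<zero>\<^bsub>L\<^esub>) \<and>
     (\<forall>x\<in>carrier L. \<forall>y\<in>carrier L. \<forall>z\<in>carrier L.
        x \<otimes>\<^bsub>L\<^esub> (y \<otimes>\<^bsub>L\<^esub> z) \<oplus>\<^bsub>L\<^esub> y \<otimes>\<^bsub>L\<^esub> (z \<otimes>\<^bsub>L\<^esub> x) \<oplus>\<^bsub>L\<^esub> z \<otimes>\<^bsub>L\<^esub> (x \<otimes>\<^bsub>L\<^esub> y) = \<zero>\<^bsub>L\<^esub>)"

definition inner_product_on :: "(real, 'a) module \<Rightarrow> ('a \<Rightarrow> 'a \<Rightarrow> real) \<Rightarrow> bool" where
  "inner_product_on L ip \<longleftrightarrow>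
     (\<forall>x\<in>carrier L. \<forall>y\<in>carrier L. ip x y = ip y x) \<and>
     (\<forall>x\<in>carrier L. \<forall>y\<in>carrier L. \<forall>z\<in>carrier L. ip (x \<oplus>\<^bsub>L\<^esub> y) z = ip x z + ip y z) \<and>
     (\<forall>c. \<forall>x\<in>carrier L. \<forall>y\<in>carrier L. ip (c \<odot>\<^bsub>L\<^esub> x) y = c * ip x y) \<and>
     (\<forall>x\<in>carrier L. x \<noteq> \<zero>\<^bsub>L\<^esub> \<longrightarrow> ip x x > 0)"

definition metric_lie_algebra :: "(real, 'a) module \<Rightarrow> ('a \<Rightarrow> 'a \<Rightarrow> real) \<Rightarrow> bool" where
  "metric_lie_algebra L ip \<longleftrightarrow>
     real_lie_algebra L \<and> vectorspace.fin_dim class_ring L \<and> inner_product_on L ip"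

definition levi_civita :: "(real, 'a) module \<Rightarrow> ('a \<Rightarrow> 'a \<Rightarrow> real) \<Rightarrow> 'a \<Rightarrow> 'a \<Rightarrow> 'a" where
  "levi_civita L ip X Y =
     (THE W. W \<in> carrier L \<and>
        (\<forall>Z\<in>carrier L. 2 * ip W Z = ip (X \<otimes>\<^bsub>L\<^esub> Y) Z + ip (Z \<otimes>\<^bsub>L\<^esub> X) Y + ip X (Z \<otimes>\<^bsub>L\<^esub> Y)))"

definition curvature :: "(real, 'a) module \<Rightarrow> ('a \<Rightarrow> 'a \<Rightarrow> real) \<Rightarrow> 'a \<Rightarrow> 'a \<Rightarrow> 'a \<Rightarrow> 'a" where
  "curvature L ip X Y Z =
     levi_civita L ip X (levi_civita L ip Y Z) \<ominus>\<^bsub>L\<^esub> levi_civita L ip Y (levi_civita L ip X Z)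
       \<ominus>\<^bsub>L\<^esub> levi_civita L ip (X \<otimes>\<^bsub>L\<^esub> Y) Z"

definition orthonormal_basis :: "(real, 'a) module \<Rightarrow> ('a \<Rightarrow> 'a \<Rightarrow> real) \<Rightarrow> 'a set \<Rightarrow> bool" where
  "orthonormal_basis L ip B \<longleftrightarrow>
     finite B \<and> vectorspace.basis class_ring L B \<and>
     (\<forall>x\<in>B. \<forall>y\<in>B. ip x y = (if x = y then 1 else 0))"

definition ricci :: "(real, 'a) module \<Rightarrow> ('a \<Rightarrow> 'a \<Rightarrow> real) \<Rightarrow> 'a set \<Rightarrow> 'a \<Rightarrow> 'a" where
  "ricci L ip B X = (\<Oplus>\<^bsub>L\<^esub>e\<in>B. curvature L ip X e e)"

definition derivations :: "(real, 'a) module \<Rightarrow> ('a \<Rightarrow> 'a) set" where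
  "derivations L =
     {D \<in> module_hom class_ring L L. \<forall>x\<in>carrier L. \<forall>y\<in>carrier L.
        D (x \<otimes>\<^bsub>L\<^esub> y) = (D x \<otimes>\<^bsub>L\<^esub> y) \<oplus>\<^bsub>L\<^esub> (x \<otimes>\<^bsub>L\<^esub> D y)}"

text \<open>An orthonormal basis always exists and \<open>ricci L ip B\<close> does not depend on the orthonormal
  basis \<open>B\<close>, so asking for some \<open>B\<close> or for all \<open>B\<close> is the same.\<close>

definition algebraic_ricci_soliton ::
    "(real, 'a) module \<Rightarrow> ('a \<Rightarrow> 'a \<Rightarrow> real) \<Rightarrow> real \<Rightarrow> bool" where
  "algebraic_ricci_soliton L ip c \<longleftrightarrow>
     metric_lie_algebra L ip \<and>
     (\<exists>B. orthonormal_basis L ip B \<and>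
        (\<exists>D\<in>derivations L. \<forall>X\<in>carrier L. ricci L ip B X = (c \<odot>\<^bsub>L\<^esub> X) \<oplus>\<^bsub>L\<^esub> D X))"

end

theory Submission
  imports Defs
begin

text \<open>Write \<open>a < b\<close> if there is a path from \<open>a\<close> to \<open>b\<close>. As the Hasse quiver has no arrow parallel to a
  longer path, the quotient algebra has a basis consisting of one class \<open>f a b\<close> for each pair
  \<open>a < b\<close>, with \<open>f a b * f b c = f a c\<close>, and of the central differences of the extra arrows and the
  original arrows parallel to them. Declare it orthogonal, the differences being unit vectors and
  \<open>f a b\<close> having squared length \<open>w a\<close>. Then \<open>Ric\<close> is diagonal, with eigenvalue \<open>0\<close> on the differences and
  half of \<open>(\<Sum>x | a < x \<and> x < b. 1 / w x) - card {x. b < x} / w b - card {x. x < a} / w a\<close> on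
  \<open>f a b\<close>. In an array TAOS two vertices between \<open>a\<close> and \<open>b\<close> are comparable or have the same
  vertices above and below them; for components this is preserved because everything above or below an
  inner vertex, and hence everything between \<open>a\<close> and \<open>b\<close>, lies in a single component. Hence
  the vertices between \<open>a\<close> and \<open>c\<close> are those between \<open>a\<close> and \<open>b\<close>, those between \<open>b\<close> and \<open>c\<close>, and the
  siblings of \<open>b\<close>, so that with \<open>w b = (card (siblings b) + card {x. b < x} + card {x. x < b}) / 2\<close>
  the eigenvalues of \<open>Ric + id\<close> are additive along products, that is, \<open>Ric + id\<close> is a derivation.\<close>

no_notation set_add (infixl "<+>\<index>" 60)
no_notation vwalk_join (infixr "\<oplus>" 65)

section \<open>Ricci curvature in orthonormal coordinates\<close>

text \<open>The algebra in question is a quotient whose elements are sets, so everything is computed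
  with real coordinate functions. These vanish outside \<open>I\<close> and can therefore be
  compared at every index. The inner product will be the one that makes the coordinates
  orthonormal.\<close>

locale coordinatized =
  fixes L :: "(real, 'a) module" (structure) and I :: "'i set" and \<psi> :: "'a \<Rightarrow> 'i \<Rightarrow> real"
  assumes finite_index: "finite I"
    and bij_coord: "bij_betw \<psi> (carrier L) {f. \<forall>i. i \<notin> I \<longrightarrow> f i = 0}"
    and add_closed: "x \<in> carrier L \<Longrightarrow> y \<in> carrier L \<Longrightarrow> x \<oplus> y \<in> carrier L"
    and coord_add: "x \<in> carrier L \<Longrightarrow> y \<in> carrier L \<Longrightarrow> \<psi> (x \<oplus> y) i = \<psi> x i + \<psi> y i"
    and zero_closed: "\<zero> \<in> carrier L"
    and coord_zero: "\<psi> \<zero> i = 0"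
    and smult_closed: "x \<in> carrier L \<Longrightarrow> c \<odot>\<^bsub>L\<^esub> x \<in> carrier L"
    and coord_smult: "x \<in> carrier L \<Longrightarrow> \<psi> (c \<odot>\<^bsub>L\<^esub> x) i = c * \<psi> x i"
begin

lemma coord_outside: "x \<in> carrier L \<Longrightarrow> i \<notin> I \<Longrightarrow> \<psi> x i = 0"
  using bij_betw_apply[OF bij_coord] by auto

lemma coord_eqI:
  assumes "x \<in> carrier L" "y \<in> carrier L" "\<And>i. i \<in> I \<Longrightarrow> \<psi> x i = \<psi> y i"
  shows "x = y"
proof -
  have "\<psi> x i = \<psi> y i" for i
    using assms coord_outside by (cases "i \<in> I") auto
  then have "\<psi> x = \<psi> y" by blast
  then show ?thesis using bij_coord assms by (auto simp: bij_betw_def dest: inj_onD)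
qed

text \<open>\<open>f\<close> is cut off outside \<open>I\<close>, so that a preimage exists for
  every \<open>f\<close>.\<close>

definition of_coord :: "('i \<Rightarrow> real) \<Rightarrow> 'a" where
  "of_coord f = inv_into (carrier L) \<psi> (\<lambda>i. if i \<in> I then f i else 0)"

lemma of_coord_closed [simp]: "of_coord f \<in> carrier L"
  unfolding of_coord_def
  by (rule inv_into_into) (use bij_coord in \<open>auto simp: bij_betw_def\<close>)

lemma coord_of_coord: "\<psi> (of_coord f) i = (if i \<in> I then f i else 0)"
proof -
  have "\<psi> (of_coord f) = (\<lambda>i. if i \<in> I then f i else 0)"
    unfolding of_coord_def by (rule f_inv_into_f) (use bij_coord in \<open>auto simp: bij_betw_def\<close>)
  then show ?thesis by simp
qed

lemma abelian_group: "abelian_group L"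
proof (rule abelian_groupI)
  fix x assume x: "x \<in> carrier L"
  show "\<exists>y\<in>carrier L. y \<oplus> x = \<zero>"
    by (rule bexI[of _ "(-1) \<odot>\<^bsub>L\<^esub> x"], rule coord_eqI)
      (use x in \<open>auto simp: add_closed zero_closed smult_closed coord_add coord_smult coord_zero\<close>)
qed (auto intro!: coord_eqI simp: add_closed zero_closed coord_add coord_zero)

lemma vectorspace: "vectorspace class_ring L"
  unfolding vectorspace_def
proof (intro conjI)
  show "Module.module class_ring L"
    by (rule moduleI)
      (auto intro!: coord_eqI abelian_group class_cring.cring_axioms
        simp: add_closed smult_closed coord_add coord_smult algebra_simps)
  show "field (class_ring :: real ring)" by (rule class_field)
qed

lemma coord_minus:
  assumes "x \<in> carrier L" "y \<in> carrier L"
  shows "x \<ominus> y \<in> carrier L" "\<psi> (x \<ominus> y) i = \<psi> x i - \<psi> y i"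
proof -
  interpret abelian_group L by (rule abelian_group)
  have "\<psi> (\<ominus> y \<oplus> y) i = 0" using assms by (simp add: l_neg coord_zero)
  then have "\<psi> (\<ominus> y) i = - \<psi> y i" using assms by (simp add: coord_add)
  then show "x \<ominus> y \<in> carrier L" "\<psi> (x \<ominus> y) i = \<psi> x i - \<psi> y i"
    using assms by (auto simp: a_minus_def coord_add)
qed

lemma coord_finsum:
  assumes "\<And>s. s \<in> S \<Longrightarrow> f s \<in> carrier L"
  shows "(\<Oplus>s\<in>S. f s) \<in> carrier L" "\<psi> (\<Oplus>s\<in>S. f s) i = (\<Sum>s\<in>S. \<psi> (f s) i)"
proof -
  interpret abelian_group L by (rule abelian_group)
  show "(\<Oplus>s\<in>S. f s) \<in> carrier L" using assms by auto
  show "\<psi> (\<Oplus>s\<in>S. f s) i = (\<Sum>s\<in>S. \<psi> (f s) i)"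
    using assms
    by (induction S rule: infinite_finite_induct) (auto simp: coord_add coord_zero finsum_insert)
qed

section \<open>The standard basis and the standard inner product\<close>

definition unit_vec :: "'i \<Rightarrow> 'a" where
  "unit_vec i = of_coord (\<lambda>j. if j = i then 1 else 0)"

lemma unit_vec_closed [simp]: "unit_vec i \<in> carrier L"
  by (simp add: unit_vec_def)

lemma coord_unit_vec: "i \<in> I \<Longrightarrow> \<psi> (unit_vec i) j = (if j = i then 1 else 0)"
  by (auto simp: unit_vec_def coord_of_coord)

lemma inj_unit_vec: "inj_on unit_vec I"
  by (rule inj_onI) (metis coord_unit_vec zero_neq_one)

lemma unit_vec_eq_iff: "i \<in> I \<Longrightarrow> j \<in> I \<Longrightarrow> unit_vec i = unit_vec j \<longleftrightarrow> i = j"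
  using inj_unit_vec by (auto dest: inj_onD)

lemma sum_unit_vec: "(\<Sum>b\<in>unit_vec ` I. g b) = (\<Sum>i\<in>I. g (unit_vec i))"
  by (simp add: sum.reindex inj_unit_vec)

text \<open>The coefficient of \<open>unit_vec i\<close> in a linear combination is its coordinate
  at \<open>i\<close>, which yields existence and uniqueness of the coefficients at once.\<close>

lemma basis_unit_vec: "vectorspace.basis class_ring L (unit_vec ` I)"
proof -
  interpret vs: vectorspace class_ring L by (rule vectorspace)
  have lin: "vs.lincomb a (unit_vec ` I) \<in> carrier L"
    "i \<in> I \<Longrightarrow> \<psi> (vs.lincomb a (unit_vec ` I)) i = a (unit_vec i)" for a i
  proof -
    show "vs.lincomb a (unit_vec ` I) \<in> carrier L"
      unfolding vs.lincomb_def by (rule coord_finsum) (auto simp: smult_closed)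
    assume i: "i \<in> I"
    have "\<psi> (vs.lincomb a (unit_vec ` I)) i = (\<Sum>j\<in>I. a (unit_vec j) * \<psi> (unit_vec j) i)"
      unfolding vs.lincomb_def
      by (subst coord_finsum) (auto simp: smult_closed coord_smult sum_unit_vec)
    also have "\<dots> = (\<Sum>j\<in>I. if j = i then a (unit_vec j) else 0)"
      by (rule sum.cong) (auto simp: coord_unit_vec)
    also have "\<dots> = a (unit_vec i)" using i finite_index by simp
    finally show "\<psi> (vs.lincomb a (unit_vec ` I)) i = a (unit_vec i)" .
  qed
  show ?thesis
  proof (subst vs.basis_criterion)
    show "\<forall>v. v \<in> carrier L \<longrightarrow>
      (\<exists>!a. a \<in> unit_vec ` I \<rightarrow>\<^sub>E carrier class_ring \<and> vs.lincomb a (unit_vec ` I) = v)"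
    proof (intro allI impI)
      fix v assume v: "v \<in> carrier L"
      \<comment> \<open>Uniqueness is asked among extensional functions, hence the restriction to
        the basis.\<close>
      let ?a = "restrict (\<lambda>b. \<psi> v (inv_into I unit_vec b)) (unit_vec ` I)"
      show "\<exists>!a. a \<in> unit_vec ` I \<rightarrow>\<^sub>E carrier class_ring \<and> vs.lincomb a (unit_vec ` I) = v"
      proof (rule ex1I[of _ ?a], intro conjI)
        show "vs.lincomb ?a (unit_vec ` I) = v"
          by (rule coord_eqI) (use v lin in \<open>auto simp: inv_into_f_f[OF inj_unit_vec]\<close>)
        fix a assume a: "a \<in> unit_vec ` I \<rightarrow>\<^sub>E carrier class_ring \<and> vs.lincomb a (unit_vec ` I) = v"
        show "a = ?a"
        proof
          fix b show "a b = ?a b"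
          proof (cases "b \<in> unit_vec ` I")
            case True
            then obtain i where i: "i \<in> I" "b = unit_vec i" by blast
            have "a b = \<psi> v i" using lin(2)[OF i(1), of a] a i by simp
            then show ?thesis using i by (simp add: inv_into_f_f[OF inj_unit_vec])
          next
            case False
            moreover have "a b = undefined" using a PiE_arb[OF _ False] by blast
            ultimately show ?thesis by simp
          qed
        qed
      qed simp
    qed
  qed (auto simp: finite_index)
qed

lemma fin_dim: "vectorspace.fin_dim class_ring L"
proof -
  interpret vs: vectorspace class_ring L by (rule vectorspace)
  show ?thesis
    using basis_unit_vec finite_index unfolding vs.fin_dim_def vs.basis_def by blast
qed

definition coord_ip :: "'a \<Rightarrow> 'a \<Rightarrow> real" where
  "coord_ip x y = (\<Sum>i\<in>I. \<psi> x i * \<psi> y i)"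

lemma coord_ip_unit_vec: "i \<in> I \<Longrightarrow> coord_ip x (unit_vec i) = \<psi> x i"
proof -
  assume i: "i \<in> I"
  have "coord_ip x (unit_vec i) = (\<Sum>j\<in>I. if j = i then \<psi> x j else 0)"
    unfolding coord_ip_def using i by (intro sum.cong) (auto simp: coord_unit_vec)
  then show ?thesis using i finite_index by simp
qed

lemma inner_product_coord_ip: "inner_product_on L coord_ip"
  unfolding inner_product_on_def
proof (intro conjI ballI allI impI)
  fix x assume x: "x \<in> carrier L" "x \<noteq> \<zero>"
  then obtain i where "i \<in> I" "\<psi> x i \<noteq> 0"
    using coord_eqI[OF x(1) zero_closed] by (auto simp: coord_zero)
  then show "0 < coord_ip x x"
    unfolding coord_ip_def by (intro sum_pos2[OF finite_index, of i]) (auto simp: zero_less_mult_iff linorder_neq_iff)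
next
  fix x y assume "x \<in> carrier L" "y \<in> carrier L"
  show "coord_ip x y = coord_ip y x" by (simp add: coord_ip_def mult.commute)
next
  fix x y z assume "x \<in> carrier L" "y \<in> carrier L" "z \<in> carrier L"
  then show "coord_ip (x \<oplus> y) z = coord_ip x z + coord_ip y z"
    by (simp add: coord_ip_def coord_add distrib_right sum.distrib)
next
  fix c x y assume "x \<in> carrier L" "y \<in> carrier L"
  then show "coord_ip (c \<odot>\<^bsub>L\<^esub> x) y = c * coord_ip x y"
    by (simp add: coord_ip_def coord_smult sum_distrib_left mult.assoc)
qed

lemma orthonormal_unit_vec: "orthonormal_basis L coord_ip (unit_vec ` I)"
  unfolding orthonormal_basis_def
  by (auto simp: finite_index basis_unit_vec coord_ip_unit_vec coord_unit_vec unit_vec_eq_iff)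

end

section \<open>Metric Lie algebras in terms of structure constants\<close>

locale coordinatized_lie_algebra = coordinatized L I \<psi>
  for L :: "(real, 'a) module" (structure) and I :: "'i set" and \<psi> :: "'a \<Rightarrow> 'i \<Rightarrow> real" +
  fixes C :: "'i \<Rightarrow> 'i \<Rightarrow> 'i \<Rightarrow> real"
  assumes mult_closed: "x \<in> carrier L \<Longrightarrow> y \<in> carrier L \<Longrightarrow> x \<otimes> y \<in> carrier L"
    and coord_mult: "x \<in> carrier L \<Longrightarrow> y \<in> carrier L \<Longrightarrow> k \<in> I \<Longrightarrow>
      \<psi> (x \<otimes> y) k = (\<Sum>i\<in>I. \<Sum>j\<in>I. C i j k * \<psi> x i * \<psi> y j)"
    and antisym: "i \<in> I \<Longrightarrow> j \<in> I \<Longrightarrow> k \<in> I \<Longrightarrow> C i j k = - C j i k"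
    and jacobi: "x \<in> carrier L \<Longrightarrow> y \<in> carrier L \<Longrightarrow> z \<in> carrier L \<Longrightarrow>
      x \<otimes> (y \<otimes> z) \<oplus> y \<otimes> (z \<otimes> x) \<oplus> z \<otimes> (x \<otimes> y) = \<zero>"
begin

lemma coord_mult_flip:
  assumes "x \<in> carrier L" "y \<in> carrier L" "k \<in> I"
  shows "\<psi> (y \<otimes> x) k = - \<psi> (x \<otimes> y) k"
proof -
  have "\<psi> (y \<otimes> x) k = (\<Sum>j\<in>I. \<Sum>i\<in>I. C j i k * \<psi> y j * \<psi> x i)"
    using assms by (simp add: coord_mult)
  also have "\<dots> = (\<Sum>i\<in>I. \<Sum>j\<in>I. C j i k * \<psi> y j * \<psi> x i)"
    by (rule sum.swap)
  also have "\<dots> = (\<Sum>i\<in>I. \<Sum>j\<in>I. - (C i j k * \<psi> x i * \<psi> y j))"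
  proof (intro sum.cong refl)
    fix i j assume "i \<in> I" "j \<in> I"
    then show "C j i k * \<psi> y j * \<psi> x i = - (C i j k * \<psi> x i * \<psi> y j)"
      unfolding antisym[OF \<open>j \<in> I\<close> \<open>i \<in> I\<close> assms(3)] by simp
  qed
  also have "\<dots> = - \<psi> (x \<otimes> y) k"
    using assms by (simp only: coord_mult sum_negf)
  finally show ?thesis .
qed

lemma real_lie_algebra: "real_lie_algebra L"
  unfolding real_lie_algebra_def module_hom_def
proof (intro conjI ballI)
  fix x assume x: "x \<in> carrier L"
  have "\<psi> (x \<otimes> x) k = 0" if "k \<in> I" for k
    using coord_mult_flip[OF x x that] by simp
  then show "x \<otimes> x = \<zero>"
    by (intro coord_eqI) (auto simp: coord_zero zero_closed mult_closed x)
qed (auto intro!: coord_eqI vectorspace jacobi simp: mult_closed add_closed smult_closed coord_mult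
    coord_add coord_smult sum.distrib sum_distrib_left algebra_simps)

text \<open>Koszul's formula on the orthonormal basis: the coordinate at \<open>k\<close> of the
  covariant derivative of \<open>unit_vec j\<close> along \<open>unit_vec i\<close>.\<close>

definition christoffel :: "'i \<Rightarrow> 'i \<Rightarrow> 'i \<Rightarrow> real" where
  "christoffel i j k = (C i j k + C k i j + C k j i) / 2"

text \<open>Existence for the definite description comes from comparing trilinear forms in
  \<open>X\<close>, \<open>Y\<close>, \<open>Z\<close>, uniqueness from testing against unit
  vectors.\<close>

lemma levi_civita_coord:
  assumes X: "X \<in> carrier L" and Y: "Y \<in> carrier L"
  shows "levi_civita L coord_ip X Y = of_coord (\<lambda>k. \<Sum>i\<in>I. \<Sum>j\<in>I. christoffel i j k * \<psi> X i * \<psi> Y j)"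
    (is "_ = ?W")
  unfolding levi_civita_def
proof (rule the_equality)
  have W: "2 * coord_ip ?W Z = coord_ip (X \<otimes> Y) Z + coord_ip (Z \<otimes> X) Y + coord_ip X (Z \<otimes> Y)"
    if Z: "Z \<in> carrier L" for Z
  proof -
    \<comment> \<open>The common shape of the three terms: \<open>i\<close>, \<open>j\<close>,
      \<open>k\<close> always index \<open>X\<close>, \<open>Y\<close>, \<open>Z\<close>, so each
      term permutes only the indices of \<open>C\<close>, at the price of exchanging sums.\<close>
    let ?T = "\<lambda>c. \<Sum>k\<in>I. \<Sum>i\<in>I. \<Sum>j\<in>I. c i j k * (\<psi> X i * \<psi> Y j * \<psi> Z k)"
    have "coord_ip (X \<otimes> Y) Z = ?T C"
      unfolding coord_ip_def using X Y Z
      by (auto simp: coord_mult sum_distrib_right sum_distrib_left algebra_simps intro!: sum.cong)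
    moreover have "coord_ip (Z \<otimes> X) Y = ?T (\<lambda>i j k. C k i j)"
    proof -
      have "coord_ip (Z \<otimes> X) Y = (\<Sum>j\<in>I. \<Sum>k\<in>I. \<Sum>i\<in>I. C k i j * (\<psi> X i * \<psi> Y j * \<psi> Z k))"
        unfolding coord_ip_def using X Y Z
        by (auto simp: coord_mult sum_distrib_right sum_distrib_left algebra_simps intro!: sum.cong)
      also have "\<dots> = (\<Sum>k\<in>I. \<Sum>j\<in>I. \<Sum>i\<in>I. C k i j * (\<psi> X i * \<psi> Y j * \<psi> Z k))"
        by (rule sum.swap)
      also have "\<dots> = ?T (\<lambda>i j k. C k i j)"
        by (intro sum.cong refl sum.swap)
      finally show ?thesis .
    qed
    moreover have "coord_ip X (Z \<otimes> Y) = ?T (\<lambda>i j k. C k j i)"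
    proof -
      have "coord_ip X (Z \<otimes> Y) = (\<Sum>i\<in>I. \<Sum>k\<in>I. \<Sum>j\<in>I. C k j i * (\<psi> X i * \<psi> Y j * \<psi> Z k))"
        unfolding coord_ip_def using X Y Z
        by (auto simp: coord_mult sum_distrib_right sum_distrib_left algebra_simps intro!: sum.cong)
      also have "\<dots> = ?T (\<lambda>i j k. C k j i)"
        by (rule sum.swap)
      finally show ?thesis .
    qed
    moreover have "2 * coord_ip ?W Z = ?T (\<lambda>i j k. 2 * christoffel i j k)"
      unfolding coord_ip_def
      by (auto simp: coord_of_coord sum_distrib_right sum_distrib_left algebra_simps intro!: sum.cong)
    moreover have "?T (\<lambda>i j k. 2 * christoffel i j k) = ?T C + ?T (\<lambda>i j k. C k i j) + ?T (\<lambda>i j k. C k j i)"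
      unfolding sum.distrib[symmetric] by (intro sum.cong refl) (simp add: christoffel_def algebra_simps)
    ultimately show ?thesis by simp
  qed
  then show "?W \<in> carrier L \<and> (\<forall>Z\<in>carrier L. 2 * coord_ip ?W Z =
      coord_ip (X \<otimes> Y) Z + coord_ip (Z \<otimes> X) Y + coord_ip X (Z \<otimes> Y))" by simp
  fix W assume W': "W \<in> carrier L \<and> (\<forall>Z\<in>carrier L. 2 * coord_ip W Z =
      coord_ip (X \<otimes> Y) Z + coord_ip (Z \<otimes> X) Y + coord_ip X (Z \<otimes> Y))"
  show "W = ?W"
  proof (rule coord_eqI)
    fix i assume i: "i \<in> I"
    have "2 * coord_ip W (unit_vec i) = 2 * coord_ip ?W (unit_vec i)"
      using W' W[of "unit_vec i"] by simp
    then show "\<psi> W i = \<psi> ?W i" using i by (simp add: coord_ip_unit_vec)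
  qed (use W' in auto)
qed

lemma levi_civita_closed:
  "X \<in> carrier L \<Longrightarrow> Y \<in> carrier L \<Longrightarrow> levi_civita L coord_ip X Y \<in> carrier L"
  by (simp add: levi_civita_coord)

lemma coord_levi_civita:
  "X \<in> carrier L \<Longrightarrow> Y \<in> carrier L \<Longrightarrow> k \<in> I \<Longrightarrow>
    \<psi> (levi_civita L coord_ip X Y) k = (\<Sum>i\<in>I. \<Sum>j\<in>I. christoffel i j k * \<psi> X i * \<psi> Y j)"
  by (simp add: levi_civita_coord coord_of_coord)

lemma curvature_closed:
  "X \<in> carrier L \<Longrightarrow> Y \<in> carrier L \<Longrightarrow> Z \<in> carrier L \<Longrightarrow> curvature L coord_ip X Y Z \<in> carrier L"
  by (simp add: curvature_def coord_minus levi_civita_closed mult_closed)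

text \<open>By \<open>trace0\<close> and antisymmetry the derivative of each basis vector along
  itself vanishes, which removes one of the three curvature terms.\<close>

lemma coord_curvature_unit_vec:
  assumes trace0: "\<And>i j. i \<in> I \<Longrightarrow> j \<in> I \<Longrightarrow> C i j j = 0"
    and X: "X \<in> carrier L" and j: "j \<in> I" and m: "m \<in> I"
  shows "\<psi> (curvature L coord_ip X (unit_vec j) (unit_vec j)) m =
    - (\<Sum>i\<in>I. \<psi> X i * (\<Sum>p\<in>I. christoffel i j p * christoffel j p m + C i j p * christoffel p j m))"
proof -
  let ?e = "unit_vec j"
  let ?N = "levi_civita L coord_ip"
  have Nee: "?N ?e ?e = \<zero>"
  proof (rule coord_eqI)
    fix k assume k: "k \<in> I"
    have "christoffel j j k = 0"
      using trace0[OF k j] antisym[OF j j k] by (simp add: christoffel_def)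
    then show "\<psi> (?N ?e ?e) k = \<psi> \<zero> k"
      using k j by (simp add: coord_levi_civita coord_zero coord_unit_vec finite_index
          if_distrib sum.delta cong: if_cong)
  qed (auto simp: levi_civita_closed zero_closed)
  have 1: "\<psi> (?N X (?N ?e ?e)) m = 0"
    unfolding Nee using X m by (simp add: coord_levi_civita zero_closed coord_zero)
  have NXe: "\<psi> (?N X ?e) p = (\<Sum>i\<in>I. christoffel i j p * \<psi> X i)" if "p \<in> I" for p
    using X j that by (simp add: coord_levi_civita coord_unit_vec finite_index if_distrib sum.delta cong: if_cong)
  have Xe: "\<psi> (X \<otimes> ?e) p = (\<Sum>i\<in>I. C i j p * \<psi> X i)" if "p \<in> I" for p
    using X j that by (simp add: coord_mult coord_unit_vec finite_index if_distrib sum.delta cong: if_cong)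
  have 2: "\<psi> (?N ?e (?N X ?e)) m = (\<Sum>p\<in>I. christoffel j p m * \<psi> (?N X ?e) p)"
  proof -
    have "\<psi> (?N ?e (?N X ?e)) m = (\<Sum>i\<in>I. if i = j then \<Sum>p\<in>I. christoffel i p m * \<psi> (?N X ?e) p else 0)"
      using X j m by (subst coord_levi_civita) (auto simp: levi_civita_closed coord_unit_vec intro!: sum.cong)
    then show ?thesis using j finite_index by simp
  qed
  have 3: "\<psi> (?N (X \<otimes> ?e) ?e) m = (\<Sum>p\<in>I. christoffel p j m * \<psi> (X \<otimes> ?e) p)"
    using X j m by (subst coord_levi_civita) (simp_all add: mult_closed coord_unit_vec finite_index
        if_distrib sum.delta cong: if_cong)
  have "\<psi> (curvature L coord_ip X ?e ?e) m =
     - (\<Sum>p\<in>I. christoffel j p m * (\<Sum>i\<in>I. christoffel i j p * \<psi> X i)) - (\<Sum>p\<in>I. christoffel p j m * (\<Sum>i\<in>I. C i j p * \<psi> X i))"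
    unfolding curvature_def using X
    by (simp add: coord_minus levi_civita_closed mult_closed 1 2 3 NXe Xe)
  also have "\<dots> = - (\<Sum>p\<in>I. \<Sum>i\<in>I. \<psi> X i * (christoffel i j p * christoffel j p m + C i j p * christoffel p j m))"
    by (simp add: sum_distrib_left sum.distrib sum_negf algebra_simps)
  also have "\<dots> = - (\<Sum>i\<in>I. \<psi> X i * (\<Sum>p\<in>I. christoffel i j p * christoffel j p m + C i j p * christoffel p j m))"
    by (subst sum.swap, simp only: sum_distrib_left)
  finally show ?thesis .
qed

text \<open>The hypotheses hold in a path basis because an acyclic quiver has no closed paths; they make the
  mean curvature vector and the Killing form vanish summand by summand.\<close>

lemma ricci_matrix:
  assumes trace0: "\<And>i j. i \<in> I \<Longrightarrow> j \<in> I \<Longrightarrow> C i j j = 0"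
    and killing0: "\<And>i j p m. i \<in> I \<Longrightarrow> j \<in> I \<Longrightarrow> p \<in> I \<Longrightarrow> m \<in> I \<Longrightarrow> C i j p * C m p j = 0"
    and i: "i \<in> I" and m: "m \<in> I"
  shows "(\<Sum>j\<in>I. \<Sum>p\<in>I. christoffel i j p * christoffel j p m + C i j p * christoffel p j m) =
    (\<Sum>j\<in>I. \<Sum>p\<in>I. C i j p * C m j p) / 2 - (\<Sum>j\<in>I. \<Sum>p\<in>I. C j p i * C j p m) / 4"
proof -
  let ?S = "\<lambda>T. \<Sum>j\<in>I. \<Sum>p\<in>I. T j p :: real"
  let ?T = "\<lambda>j p. christoffel i j p * christoffel j p m + C i j p * christoffel p j m"
  let ?U = "\<lambda>j p. C i j p * C m j p / 2 - C j p i * C j p m / 4"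
  \<comment> \<open>The summands on the two sides of the claim differ; they agree only after
    averaging with \<open>j\<close> and \<open>p\<close> exchanged.\<close>
  have sym: "?S T = ?S (\<lambda>j p. (T j p + T p j) / 2)" for T
  proof -
    have "?S T = ?S (\<lambda>j p. T p j)" by (rule sum.swap)
    then have "2 * ?S T = ?S T + ?S (\<lambda>j p. T p j)" by simp
    then show ?thesis by (simp add: sum.distrib add_divide_distrib sum_divide_distrib[symmetric])
  qed
  have "?T j p + ?T p j = ?U j p + ?U p j" if j: "j \<in> I" and p: "p \<in> I" for j p
  proof -
    define a where "a = C i j p"
    define b where "b = C i p j"
    define c where "c = C j p i"
    define d where "d = C m j p"
    define e where "e = C m p j"
    define f where "f = C j p m"
    have eqs: "C j i p = -a" "C p i j = -b" "C p j i = -c" "C j m p = - d" "C p m j = - e" "C p j m = - f"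
      unfolding a_def b_def c_def d_def e_def f_def
      by (rule antisym; rule i m j p)+
    \<comment> \<open>Two Killing products, the second with \<open>j\<close> and \<open>p\<close>
      exchanged; the symmetrized summands differ only by multiples of these.\<close>
    have z: "a * e = 0" "b * d = 0"
      unfolding a_def b_def d_def e_def by (rule killing0; rule i m j p)+
    have "((a - b - c) / 2 * ((f + d + e) / 2) + a * ((- f + e + d) / 2)) +
        ((b - a + c) / 2 * ((- f + e + d) / 2) + b * ((f + d + e) / 2)) =
        (a * d / 2 - c * f / 4) + (b * e / 2 - (- c) * (- f) / 4)"
      using z by (auto simp: field_simps)
    then show ?thesis
      unfolding christoffel_def eqs a_def[symmetric] b_def[symmetric] c_def[symmetric] d_def[symmetric]
        e_def[symmetric] f_def[symmetric] by (simp add: algebra_simps)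
  qed
  then have "?S ?T = ?S ?U"
    by (subst (1 2) sym) (auto intro!: sum.cong)
  then show ?thesis
    by (simp add: sum_subtractf sum_divide_distrib)
qed

text \<open>By \<open>ricci_matrix\<close> the left side of \<open>diagonal\<close> is the matrix of
  Ric, so Ric is \<open>c\<close> times the identity plus the diagonal operator with entries
  \<open>d\<close>. A diagonal operator is a derivation as soon as its eigenvalues add along nonzero
  structure constants.\<close>

theorem algebraic_ricci_solitonI:
  assumes trace0: "\<And>i j. i \<in> I \<Longrightarrow> j \<in> I \<Longrightarrow> C i j j = 0"
    and killing0: "\<And>i j p m. i \<in> I \<Longrightarrow> j \<in> I \<Longrightarrow> p \<in> I \<Longrightarrow> m \<in> I \<Longrightarrow> C i j p * C m p j = 0"
    and diagonal: "\<And>i m. i \<in> I \<Longrightarrow> m \<in> I \<Longrightarrow>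
      (\<Sum>j\<in>I. \<Sum>p\<in>I. C j p i * C j p m) / 4 - (\<Sum>j\<in>I. \<Sum>p\<in>I. C i j p * C m j p) / 2 =
      (if i = m then c + d m else 0)"
    and additive: "\<And>i j k. i \<in> I \<Longrightarrow> j \<in> I \<Longrightarrow> k \<in> I \<Longrightarrow> C i j k \<noteq> 0 \<Longrightarrow> d k = d i + d j"
  shows "algebraic_ricci_soliton L coord_ip c"
proof -
  let ?D = "\<lambda>x. of_coord (\<lambda>k. d k * \<psi> x k)"
  have "?D (x \<otimes> y) = (?D x \<otimes> y) \<oplus> (x \<otimes> ?D y)" if x: "x \<in> carrier L" and y: "y \<in> carrier L" for x y
  proof (rule coord_eqI)
    fix k assume k: "k \<in> I"
    have *: "d k * (C i j k * \<psi> x i * \<psi> y j) =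
       C i j k * (d i * \<psi> x i) * \<psi> y j + C i j k * \<psi> x i * (d j * \<psi> y j)" if "i \<in> I" "j \<in> I" for i j
      using additive[of i j k] that k by (cases "C i j k = 0") (auto simp: algebra_simps)
    have "\<psi> (?D (x \<otimes> y)) k = (\<Sum>i\<in>I. \<Sum>j\<in>I. d k * (C i j k * \<psi> x i * \<psi> y j))"
      using x y k by (simp add: coord_of_coord coord_mult sum_distrib_left)
    also have "\<dots> = (\<Sum>i\<in>I. \<Sum>j\<in>I. C i j k * (d i * \<psi> x i) * \<psi> y j + C i j k * \<psi> x i * (d j * \<psi> y j))"
      by (intro sum.cong refl *)
    also have "\<dots> = \<psi> ((?D x \<otimes> y) \<oplus> (x \<otimes> ?D y)) k"
      using x y k by (simp add: coord_of_coord coord_add coord_mult mult_closed sum.distrib)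
    finally show "\<psi> (?D (x \<otimes> y)) k = \<psi> ((?D x \<otimes> y) \<oplus> (x \<otimes> ?D y)) k" .
  qed (use x y in \<open>auto simp: mult_closed add_closed\<close>)
  then have D: "?D \<in> derivations L"
    unfolding derivations_def module_hom_def
    by (auto intro!: coord_eqI simp: add_closed smult_closed coord_of_coord coord_add coord_smult algebra_simps)
  have ric: "ricci L coord_ip (unit_vec ` I) X = (c \<odot>\<^bsub>L\<^esub> X) \<oplus> ?D X" if X: "X \<in> carrier L" for X
  proof (rule coord_eqI)
    fix m assume m: "m \<in> I"
    have "\<psi> (ricci L coord_ip (unit_vec ` I) X) m =
      (\<Sum>j\<in>I. \<psi> (curvature L coord_ip X (unit_vec j) (unit_vec j)) m)"
      unfolding ricci_def using X
      by (subst coord_finsum) (auto simp: curvature_closed sum_unit_vec)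
    also have "\<dots> = (\<Sum>j\<in>I. - (\<Sum>i\<in>I. \<psi> X i * (\<Sum>p\<in>I. christoffel i j p * christoffel j p m + C i j p * christoffel p j m)))"
      using coord_curvature_unit_vec[OF trace0 X _ m] by (intro sum.cong refl) blast
    also have "\<dots> = - (\<Sum>i\<in>I. \<psi> X i * (\<Sum>j\<in>I. \<Sum>p\<in>I. christoffel i j p * christoffel j p m + C i j p * christoffel p j m))"
      by (subst sum_negf, subst sum.swap, simp only: sum_distrib_left)
    \<comment> \<open>\<open>ricci_matrix\<close> computes the negative of Ric, whence the inner
      minus sign.\<close>
    also have "\<dots> = - (\<Sum>i\<in>I. \<psi> X i * - (if i = m then c + d m else 0))"
    proof (intro arg_cong[where f=uminus] sum.cong refl)
      fix i assume i: "i \<in> I"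
      have *: "(\<Sum>j\<in>I. \<Sum>p\<in>I. christoffel i j p * christoffel j p m + C i j p * christoffel p j m) =
          (\<Sum>j\<in>I. \<Sum>p\<in>I. C i j p * C m j p) / 2 - (\<Sum>j\<in>I. \<Sum>p\<in>I. C j p i * C j p m) / 4"
        by (rule ricci_matrix) (use trace0 killing0 i m in auto)
      show "\<psi> X i * (\<Sum>j\<in>I. \<Sum>p\<in>I. christoffel i j p * christoffel j p m + C i j p * christoffel p j m) =
          \<psi> X i * - (if i = m then c + d m else 0)"
        unfolding * diagonal[OF i m, symmetric] by simp
    qed
    also have "\<dots> = (\<Sum>i\<in>I. if i = m then \<psi> X i * (c + d i) else 0)"
      by (subst sum_negf[symmetric], rule sum.cong) auto
    also have "\<dots> = \<psi> X m * (c + d m)"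
      using m finite_index by simp
    finally show "\<psi> (ricci L coord_ip (unit_vec ` I) X) m = \<psi> ((c \<odot>\<^bsub>L\<^esub> X) \<oplus> ?D X) m"
      using X m by (simp add: coord_add smult_closed coord_smult coord_of_coord algebra_simps)
  next
    show "ricci L coord_ip (unit_vec ` I) X \<in> carrier L"
      unfolding ricci_def using X by (intro coord_finsum) (auto simp: curvature_closed)
  qed (use X in \<open>auto simp: add_closed smult_closed\<close>)
  show ?thesis
    unfolding algebraic_ricci_soliton_def metric_lie_algebra_def
    by (intro conjI real_lie_algebra fin_dim inner_product_coord_ip
        exI[of _ "unit_vec ` I"] orthonormal_unit_vec bexI[of _ ?D] D ballI ric)
qed

end

section \<open>Layered orders\<close>

text \<open>Products of basis classes are sparse: the pairs with a nonzero summand will be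
  parametrized by a single vertex through \<open>h\<close>.\<close>

lemma double_sum_reindex:
  fixes f :: "'i \<Rightarrow> 'i \<Rightarrow> real"
  assumes "finite I" and "inj_on h B" and "h ` B \<subseteq> I \<times> I"
    and "\<And>j p. j \<in> I \<Longrightarrow> p \<in> I \<Longrightarrow> (j, p) \<notin> h ` B \<Longrightarrow> f j p = 0"
  shows "(\<Sum>j\<in>I. \<Sum>p\<in>I. f j p) = (\<Sum>b\<in>B. f (fst (h b)) (snd (h b)))"
proof -
  have "(\<Sum>j\<in>I. \<Sum>p\<in>I. f j p) = (\<Sum>x\<in>I \<times> I. f (fst x) (snd x))"
    by (simp add: sum.cartesian_product case_prod_beta)
  also have "\<dots> = (\<Sum>x\<in>h ` B. f (fst x) (snd x))"
    by (rule sum.mono_neutral_right) (use assms in auto)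
  also have "\<dots> = (\<Sum>b\<in>B. f (fst (h b)) (snd (h b)))"
    by (simp add: sum.reindex assms)
  finally show ?thesis .
qed

text \<open>The only trace of the array structure in the curvature computation. It compares only
  vertices inside a common interval, so it can be checked on components; the last alternative also
  covers equal vertices.\<close>

definition layered :: "('v \<times> 'v) set \<Rightarrow> bool" where
  "layered R \<longleftrightarrow> (\<forall>a b b' c. (a, b) \<in> R \<longrightarrow> (b, c) \<in> R \<longrightarrow> (a, b') \<in> R \<longrightarrow> (b', c) \<in> R \<longrightarrow>
     (b, b') \<in> R \<or> (b', b) \<in> R \<or> R `` {b} = R `` {b'} \<and> R\<inverse> `` {b} = R\<inverse> `` {b'})"

lemma layeredD:
  assumes "layered R" "(a, b) \<in> R" "(b, c) \<in> R" "(a, b') \<in> R" "(b', c) \<in> R"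
  shows "(b, b') \<in> R \<or> (b', b) \<in> R \<or> R `` {b} = R `` {b'} \<and> R\<inverse> `` {b} = R\<inverse> `` {b'}"
  using assms unfolding layered_def by blast

locale layered_order =
  fixes R :: "('v \<times> 'v) set"
  assumes finite_R: "finite R" and trans_R: "trans R" and irrefl_R: "(a, a) \<notin> R"
    and layered_R: "layered R"
begin

lemma R_trans: "(a, b) \<in> R \<Longrightarrow> (b, c) \<in> R \<Longrightarrow> (a, c) \<in> R"
  using trans_R by (rule transD)

lemma R_asym: "(a, b) \<in> R \<Longrightarrow> (b, a) \<notin> R"
  using R_trans irrefl_R by blast

abbreviation between :: "'v \<Rightarrow> 'v \<Rightarrow> 'v set" where
  "between a c \<equiv> {b. (a, b) \<in> R \<and> (b, c) \<in> R}"

text \<open>A vertex of the field is its own sibling, which makes \<open>weight\<close> positive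
  there.\<close>

definition siblings :: "'v \<Rightarrow> 'v set" where
  "siblings b = {b' \<in> Field R. R `` {b} = R `` {b'} \<and> R\<inverse> `` {b} = R\<inverse> `` {b'}}"

text \<open>The squared length of the class of all paths from \<open>a\<close> to any other vertex. The structure
  constants of the normalized classes then depend only on the middle vertex, and these values make
  \<open>degree\<close> below additive.\<close>

definition weight :: "'v \<Rightarrow> real" where
  "weight b = (card (siblings b) + card (R `` {b}) + card (R\<inverse> `` {b})) / 2"

lemma finite_sets [simp]:
  "finite (between a c)" "finite (R `` {b})" "finite (R\<inverse> `` {b})" "finite (siblings b)"
proof -
  have "between a c \<subseteq> Field R" "R `` {b} \<subseteq> Field R" "R\<inverse> `` {b} \<subseteq> Field R" "siblings b \<subseteq> Field R"
    by (auto simp: siblings_def Field_def)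
  then show "finite (between a c)" "finite (R `` {b})" "finite (R\<inverse> `` {b})" "finite (siblings b)"
    using finite_R by (auto intro: finite_subset finite_Field)
qed

lemma weight_pos: "b \<in> Field R \<Longrightarrow> weight b > 0"
proof -
  assume "b \<in> Field R"
  then have "b \<in> siblings b" by (simp add: siblings_def)
  then have "card (siblings b) > 0" by (auto simp: card_gt_0_iff)
  then show ?thesis by (simp add: weight_def)
qed

lemma weight_nonneg: "weight b \<ge> 0"
  by (simp add: weight_def)

lemma weight_sibling: "b' \<in> siblings b \<Longrightarrow> weight b' = weight b"
  by (simp add: weight_def siblings_def)

text \<open>By layeredness a vertex between \<open>a\<close> and \<open>c\<close> is below
  \<open>b\<close>, above \<open>b\<close> or a sibling of \<open>b\<close>, and siblings share the
  weight of \<open>b\<close>.\<close>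

lemma sum_between_split:
  assumes ab: "(a, b) \<in> R" and bc: "(b, c) \<in> R"
  shows "(\<Sum>x\<in>between a c. 1 / weight x) =
    (\<Sum>x\<in>between a b. 1 / weight x) + (\<Sum>x\<in>between b c. 1 / weight x) +
    2 - (card (R `` {b}) + card (R\<inverse> `` {b})) / weight b"
proof -
  have "x \<in> between a c \<longleftrightarrow> x \<in> between a b \<union> between b c \<union> siblings b" for x
  proof
    assume "x \<in> between a c"
    then show "x \<in> between a b \<union> between b c \<union> siblings b"
      using layeredD[OF layered_R ab bc, of x] by (auto simp: siblings_def Field_def)
  qed (use ab bc in \<open>auto simp: siblings_def intro: R_trans\<close>)
  then have split: "between a c = between a b \<union> between b c \<union> siblings b"
    by (rule Set.set_eqI)
  have disj: "between a b \<inter> between b c = {}" "(between a b \<union> between b c) \<inter> siblings b = {}"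
    using R_asym irrefl_R by (auto simp: siblings_def)
  have "(\<Sum>x\<in>siblings b. 1 / weight x) = card (siblings b) / weight b"
    by (simp add: weight_sibling)
  moreover have "card (siblings b) / weight b = 2 - (card (R `` {b}) + card (R\<inverse> `` {b})) / weight b"
  proof -
    have "weight b > 0" using ab by (intro weight_pos) (auto simp: Field_def)
    \<comment> \<open>The definition of \<open>weight\<close> solved for the number of
      siblings.\<close>
    moreover have "card (siblings b) = 2 * weight b - (card (R `` {b}) + card (R\<inverse> `` {b}))"
      by (simp add: weight_def field_simps)
    ultimately show ?thesis by (simp add: diff_divide_distrib)
  qed
  ultimately show ?thesis
    unfolding split by (simp add: sum.union_disjoint disj)
qed

text \<open>Dividing each class by its length, the product of \<open>f a b / sqrt (weight a)\<close>
  and \<open>f b c / sqrt (weight b)\<close> is the normalized \<open>f a c\<close> times this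
  factor.\<close>

definition middle :: "'v \<Rightarrow> real" where
  "middle b = 1 / sqrt (weight b)"

lemma middle_square: "middle b ^ 2 = 1 / weight b"
  by (simp add: middle_def power_divide weight_nonneg)

text \<open>The index \<open>Inl (a, b)\<close> stands for the class of the paths from \<open>a\<close> to \<open>b\<close>, and \<open>Inr e\<close> for the
  difference of an extra arrow \<open>e\<close> and the original arrow parallel to it, which is central.\<close>

fun path_const :: "('v \<times> 'v) + 'e \<Rightarrow> ('v \<times> 'v) + 'e \<Rightarrow> ('v \<times> 'v) + 'e \<Rightarrow> real" where
  "path_const (Inl (a, b)) (Inl (b', c)) (Inl (a', c')) =
    (if b = b' \<and> a' = a \<and> c' = c then middle b else 0)"
| "path_const _ _ _ = 0"

definition lie_const :: "('v \<times> 'v) + 'e \<Rightarrow> ('v \<times> 'v) + 'e \<Rightarrow> ('v \<times> 'v) + 'e \<Rightarrow> real" where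
  "lie_const i j k = path_const i j k - path_const j i k"

text \<open>The eigenvalue of \<open>Ric + id\<close> on the basis vector of the given index; the
  leading 1 comes from the identity.\<close>

fun degree :: "('v \<times> 'v) + 'e \<Rightarrow> real" where
  "degree (Inl (a, c)) = 1 + ((\<Sum>b\<in>between a c. 1 / weight b) - card (R `` {c}) / weight c
     - card (R\<inverse> `` {a}) / weight a) / 2"
| "degree (Inr e) = 1"

section \<open>Structure constants of the commutator bracket\<close>

lemma path_const_nonzero:
  assumes "path_const i j k \<noteq> 0"
  obtains a b c where "i = Inl (a, b)" "j = Inl (b, c)" "k = Inl (a, c)"
  using assms by (cases "(i, j, k)" rule: path_const.cases) (auto split: if_splits)

text \<open>A product equal to one of its factors would make the other factor a pair
  \<open>(a, a)\<close>.\<close>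

lemma lie_const_trace:
  assumes "i \<in> R <+> E"
  shows "lie_const i j j = 0"
proof -
  have "path_const i j j = 0" "path_const j i j = 0"
    by (rule ccontr, use assms irrefl_R in \<open>auto elim!: path_const_nonzero\<close>)+
  then show ?thesis by (simp add: lie_const_def)
qed

text \<open>The middle vertex \<open>b\<close> contributes a term for the vertices above it to the
  degree of \<open>(a, b)\<close> and one for those below it to that of \<open>(b, c)\<close>.
  \<open>sum_between_split\<close> produces exactly these, and its summand 2, halved, is the second
  leading 1.\<close>

lemma degree_additive:
  assumes "i \<in> R <+> E" "j \<in> R <+> E" "lie_const i j k \<noteq> 0"
  shows "degree k = degree i + degree j"
proof -
  have *: "degree k = degree i + degree j" if "i \<in> R <+> E" "j \<in> R <+> E" "path_const i j k \<noteq> 0" for i j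
    using that(3)
  proof (rule path_const_nonzero)
    fix a b c assume eq: "i = Inl (a, b)" "j = Inl (b, c)" "k = Inl (a, c)"
    then have "(a, b) \<in> R" "(b, c) \<in> R" using that by auto
    from sum_between_split[OF this] show ?thesis
      unfolding eq by (simp add: add_divide_distrib diff_divide_distrib)
  qed
  show ?thesis
  proof -
    from assms(3) have "path_const i j k \<noteq> 0 \<or> path_const j i k \<noteq> 0" by (auto simp: lie_const_def)
    then show ?thesis using * assms(1,2) by (metis add.commute)
  qed
qed

text \<open>If both constants were nonzero, \<open>j\<close> would be a factor of \<open>p\<close>
  and \<open>p\<close> a factor of \<open>j\<close>, which a strict order excludes.\<close>

lemma lie_const_killing:
  assumes "i \<in> R <+> E" "j \<in> R <+> E" "p \<in> R <+> E" "m \<in> R <+> E"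
  shows "lie_const i j p * lie_const m p j = 0"
proof (rule ccontr)
  assume "\<not> ?thesis"
  then have "path_const i j p \<noteq> 0 \<or> path_const j i p \<noteq> 0"
    "path_const m p j \<noteq> 0 \<or> path_const p m j \<noteq> 0"
    by (auto simp: lie_const_def)
  then show False
    using assms R_asym irrefl_R by (elim disjE path_const_nonzero) auto
qed

text \<open>Nonzero mixed products would contradict the strictness of the order. In the remaining
  ones, two of the three indices determine the third, so different \<open>i\<close> and
  \<open>m\<close> give zero.\<close>

lemma lie_const_square:
  assumes "i \<in> R <+> E" "j \<in> R <+> E" "p \<in> R <+> E" "m \<in> R <+> E"
  shows "lie_const j p i * lie_const j p m =
      (if i = m then (path_const j p i)\<^sup>2 + (path_const p j i)\<^sup>2 else 0)"
    and "lie_const i j p * lie_const m j p =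
      (if i = m then (path_const i j p)\<^sup>2 + (path_const j i p)\<^sup>2 else 0)"
proof -
  have 1: "path_const j p i * path_const p j m = 0" for i m
    using assms R_asym irrefl_R by (intro mult_eq_0_iff[THEN iffD2]) (rule ccontr, auto elim!: path_const_nonzero)
  have 2: "path_const j p i * path_const j p m = 0" if "i \<noteq> m" for j p i m
    using that by (intro mult_eq_0_iff[THEN iffD2]) (rule ccontr, auto elim!: path_const_nonzero)
  show "lie_const j p i * lie_const j p m =
      (if i = m then (path_const j p i)\<^sup>2 + (path_const p j i)\<^sup>2 else 0)"
    using 1[of i m] 1[of m i] 2[of i m j p] 2[of i m p j]
    by (auto simp: lie_const_def algebra_simps power2_eq_square)
  have 3: "path_const i j p * path_const j m p = 0" if "i \<in> R <+> E" for i m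
    using that irrefl_R by (intro mult_eq_0_iff[THEN iffD2]) (rule ccontr, auto elim!: path_const_nonzero)
  have 4: "path_const i j p * path_const m j p = 0" "path_const j i p * path_const j m p = 0" if "i \<noteq> m"
    by (intro mult_eq_0_iff[THEN iffD2]; rule ccontr; use that in \<open>auto elim!: path_const_nonzero\<close>)+
  show "lie_const i j p * lie_const m j p =
      (if i = m then (path_const i j p)\<^sup>2 + (path_const j i p)\<^sup>2 else 0)"
    using 3[OF assms(1), of m] 3[OF assms(4), of i] 4
    by (auto simp: lie_const_def algebra_simps power2_eq_square)
qed

context
  fixes E :: "'e set" and a c
  assumes finite_E: "finite E" and ac: "(a, c) \<in> R"
begin

text \<open>\<open>g\<close> is general so that one reindexing serves both the squares in Ric and
  the bilinear product in \<open>path_mult_const\<close>.\<close>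

lemma sum_path_const_factor:
  fixes g :: "('v \<times> 'v) + 'e \<Rightarrow> ('v \<times> 'v) + 'e \<Rightarrow> real \<Rightarrow> real"
  assumes "\<And>j p. g j p 0 = 0"
  shows "(\<Sum>j\<in>R <+> E. \<Sum>p\<in>R <+> E. g j p (path_const j p (Inl (a, c)))) =
      (\<Sum>b\<in>between a c. g (Inl (a, b)) (Inl (b, c)) (middle b))"
proof -
  let ?h = "\<lambda>b. (Inl (a, b), Inl (b, c))"
  have "(j, p) \<in> ?h ` between a c" if "j \<in> R <+> E" "p \<in> R <+> E" "path_const j p (Inl (a, c)) \<noteq> 0" for j p
    using that(3,1,2) by (elim path_const_nonzero) auto
  then show ?thesis
    by (subst double_sum_reindex[where h = ?h and B = "between a c"])
      (use assms in \<open>auto simp: finite_E finite_R inj_on_def\<close>)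
qed

text \<open>The right multiples of the class at \<open>(a, c)\<close> correspond to the vertices
  above \<open>c\<close> and all carry the constant \<open>middle c\<close>. The next lemma is the
  mirror image.\<close>

lemma sum_path_const_right:
  "(\<Sum>j\<in>R <+> E. \<Sum>p\<in>R <+> E. (path_const (Inl (a, c)) j p)\<^sup>2) = card (R `` {c}) / weight c"
proof -
  let ?h = "\<lambda>d. (Inl (c, d), Inl (a, d))"
  have "(j, p) \<in> ?h ` (R `` {c})" if "j \<in> R <+> E" "p \<in> R <+> E" "path_const (Inl (a, c)) j p \<noteq> 0" for j p
    using that(3,1,2) by (elim path_const_nonzero) auto
  then show ?thesis
    by (subst double_sum_reindex[where h = ?h and B = "R `` {c}"])
      (use R_trans[OF ac] in \<open>auto simp: finite_E finite_R inj_on_def middle_square\<close>)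
qed

lemma sum_path_const_left:
  "(\<Sum>j\<in>R <+> E. \<Sum>p\<in>R <+> E. (path_const j (Inl (a, c)) p)\<^sup>2) = card (R\<inverse> `` {a}) / weight a"
proof -
  let ?h = "\<lambda>d. (Inl (d, a), Inl (d, c))"
  have "(j, p) \<in> ?h ` (R\<inverse> `` {a})" if "j \<in> R <+> E" "p \<in> R <+> E" "path_const j (Inl (a, c)) p \<noteq> 0" for j p
    using that(3,1,2) by (elim path_const_nonzero) auto
  then show ?thesis
    by (subst double_sum_reindex[where h = ?h and B = "R\<inverse> `` {a}"])
      (use R_trans[OF _ ac] in \<open>auto simp: finite_E finite_R inj_on_def middle_square\<close>)
qed

end

lemma lie_const_ricci:
  assumes E: "finite E" and i: "i \<in> R <+> E" and m: "m \<in> R <+> E"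
  shows "(\<Sum>j\<in>R <+> E. \<Sum>p\<in>R <+> E. lie_const j p i * lie_const j p m) / 4 -
      (\<Sum>j\<in>R <+> E. \<Sum>p\<in>R <+> E. lie_const i j p * lie_const m j p) / 2 =
    (if i = m then -1 + degree m else 0)"
proof -
  let ?S = "\<lambda>f. \<Sum>j\<in>R <+> E. \<Sum>p\<in>R <+> E. f j p :: real"
  have A: "?S (\<lambda>j p. lie_const j p i * lie_const j p m) =
      (if i = m then ?S (\<lambda>j p. (path_const j p i)\<^sup>2) + ?S (\<lambda>j p. (path_const p j i)\<^sup>2) else 0)"
    using i m by (simp add: lie_const_square sum.distrib cong: sum.cong)
  have B: "?S (\<lambda>j p. lie_const i j p * lie_const m j p) =
      (if i = m then ?S (\<lambda>j p. (path_const i j p)\<^sup>2) + ?S (\<lambda>j p. (path_const j i p)\<^sup>2) else 0)"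
    using i m by (simp add: lie_const_square sum.distrib cong: sum.cong)
  \<comment> \<open>Every factorization of \<open>i\<close> occurs in both orders, so the first sum
    doubles and its factor 1/4 becomes the 1/2 in \<open>degree\<close>.\<close>
  have C: "?S (\<lambda>j p. (path_const p j i)\<^sup>2) = ?S (\<lambda>j p. (path_const j p i)\<^sup>2)"
    by (rule sum.swap)
  show ?thesis
  proof (cases i)
    case (Inl ac)
    then obtain a c where ac: "i = Inl (a, c)" "(a, c) \<in> R" using i by (cases ac) auto
    have "?S (\<lambda>j p. (path_const j p i)\<^sup>2) = (\<Sum>b\<in>between a c. 1 / weight b)"
      unfolding ac(1) using sum_path_const_factor[OF E ac(2), of "\<lambda>_ _ x. x\<^sup>2"]
      by (simp add: middle_square)
    then show ?thesis
      unfolding A B C using sum_path_const_right[OF E ac(2)] sum_path_const_left[OF E ac(2)] ac(1)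
      by (auto simp: field_simps)
  next
    case (Inr e)
    then have "path_const j p i = 0" "path_const i j p = 0" "path_const j i p = 0" for j p
      by (auto intro: ccontr elim!: path_const_nonzero)
    then show ?thesis unfolding A B C using Inr by auto
  qed
qed

text \<open>Written over inner vertices instead of structure constants, so that associativity
  becomes an exchange of sums. The entries at \<open>Inr\<close> vanish because products involve
  only paths of length at least two.\<close>

fun path_mult :: "(('v \<times> 'v) + 'e \<Rightarrow> real) \<Rightarrow> (('v \<times> 'v) + 'e \<Rightarrow> real) \<Rightarrow> ('v \<times> 'v) + 'e \<Rightarrow> real" where
  "path_mult f g (Inl (a, c)) =
    (\<Sum>b\<in>between a c. middle b * f (Inl (a, b)) * g (Inl (b, c)))"
| "path_mult f g (Inr e) = 0"

lemma path_mult_const: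
  assumes E: "finite E" and k: "k \<in> R <+> E"
  shows "path_mult f g k = (\<Sum>i\<in>R <+> E. \<Sum>j\<in>R <+> E. path_const i j k * f i * g j)"
proof (cases k)
  case (Inl ac)
  then obtain a c where ac: "k = Inl (a, c)" "(a, c) \<in> R" using k by (cases ac) auto
  show ?thesis
    unfolding ac(1) using sum_path_const_factor[OF E ac(2), of "\<lambda>i j x. x * f i * g j"] by simp
next
  case (Inr e)
  then have "path_const i j k = 0" for i j
    by (auto intro: ccontr elim!: path_const_nonzero)
  then show ?thesis using Inr by simp
qed

lemma path_mult_lie_const:
  assumes E: "finite E" and k: "k \<in> R <+> E"
  shows "path_mult f g k - path_mult g f k =
    (\<Sum>i\<in>R <+> E. \<Sum>j\<in>R <+> E. lie_const i j k * f i * g j)"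
proof -
  have "path_mult g f k = (\<Sum>i\<in>R <+> E. \<Sum>j\<in>R <+> E. path_const j i k * f i * g j)"
    unfolding path_mult_const[OF E k] by (subst sum.swap) (simp add: mult.assoc mult.commute[of "g _"])
  then show ?thesis
    unfolding path_mult_const[OF E k, of f g] lie_const_def
    by (simp add: sum_subtractf left_diff_distrib)
qed

lemma path_mult_assoc: "path_mult (path_mult f g) h k = path_mult f (path_mult g h) k"
proof (cases k)
  case (Inl ad)
  then obtain a d where k: "k = Inl (a, d)" by (cases ad) auto
  have "path_mult (path_mult f g) h k = (\<Sum>c\<in>between a d. \<Sum>b\<in>between a c.
      middle b * middle c * f (Inl (a, b)) * g (Inl (b, c)) * h (Inl (c, d)))"
    unfolding k by (simp add: sum_distrib_left sum_distrib_right algebra_simps)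
  also have "\<dots> = (\<Sum>(c, b)\<in>Sigma (between a d) (between a).
      middle b * middle c * f (Inl (a, b)) * g (Inl (b, c)) * h (Inl (c, d)))"
    by (rule sum.Sigma) auto
  \<comment> \<open>Both index sets are the chains \<open>a < b < c < d\<close>; transitivity
    supplies the comparison that each of them leaves implicit.\<close>
  also have "\<dots> = (\<Sum>(b, c)\<in>Sigma (between a d) (\<lambda>b. between b d).
      middle b * middle c * f (Inl (a, b)) * g (Inl (b, c)) * h (Inl (c, d)))"
    by (rule sum.reindex_bij_witness[of _ prod.swap prod.swap]) (auto intro: R_trans)
  also have "\<dots> = (\<Sum>b\<in>between a d. \<Sum>c\<in>between b d.
      middle b * middle c * f (Inl (a, b)) * g (Inl (b, c)) * h (Inl (c, d)))"
    by (rule sum.Sigma[symmetric]) auto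
  also have "\<dots> = path_mult f (path_mult g h) k"
    unfolding k by (simp add: sum_distrib_left sum_distrib_right algebra_simps)
  finally show ?thesis .
qed simp

lemma path_mult_diff:
  "path_mult (\<lambda>i. f i - g i) h k = path_mult f h k - path_mult g h k"
  "path_mult h (\<lambda>i. f i - g i) k = path_mult h f k - path_mult h g k"
  by (cases "(f, h, k)" rule: path_mult.cases;
      simp add: sum.distrib sum_subtractf algebra_simps)+

end

section \<open>Hasse quivers and algebraically connected components\<close>

definition arc_order :: "('v, 'e) pre_digraph \<Rightarrow> ('v \<times> 'v) set" where
  "arc_order Q = (arcs_ends Q)\<^sup>+"

text \<open>A vertex inside an interval has something below it and is thus a chosen one. Chosen
  vertices of different columns are comparable, and those of one column have the same vertices above
  and below.\<close>

lemma array_taos_layered: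
  assumes "array_taos P r" and hasse: "hasse_quiver P r Q"
  shows "layered (arc_order Q)"
proof -
  obtain k :: nat and n m C S where
    nm: "\<forall>i\<in>{1..k}. 1 \<le> n i \<and> 1 \<le> m i \<and> m i \<le> n i" and P: "P = (\<Union>i\<in>{1..k}. C i)"
    and disj: "disjoint_family_on C {1..k}"
    and S: "\<forall>i\<in>{1..<k}. S (i + 1) \<subseteq> C (i + 1) \<and> card (S (i + 1)) = m (i + 1)"
    and r: "r = tranclp (\<lambda>a b. \<exists>i\<in>{1..<k}. a \<in> C i \<and> b \<in> S (i + 1))"
    using assms(1) unfolding array_taos_def by blast
  \<comment> \<open>A closed form of the transitive closure: only the upper vertex has to be a
    chosen one.\<close>
  define R where "R = {(a, b). \<exists>i j. 1 \<le> i \<and> i < j \<and> j \<le> k \<and> a \<in> C i \<and> b \<in> S j}"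
  have R_iff: "(a, b) \<in> R \<longleftrightarrow> (\<exists>i j. 1 \<le> i \<and> i < j \<and> j \<le> k \<and> a \<in> C i \<and> b \<in> S j)" for a b
    by (simp add: R_def)
  have S_sub: "S j \<subseteq> C j" if "1 < j" "j \<le> k" for j
    using S that by (auto dest!: bspec[of _ _ "j - 1"])
  \<comment> \<open>Since \<open>m j\<close> is at least 1, every intermediate column can be crossed
    through a chosen vertex.\<close>
  have S_ne: "\<exists>s. s \<in> S j" if "1 < j" "j \<le> k" for j
  proof -
    have "j - 1 \<in> {1..<k}" using that by auto
    then have "card (S j) = m j" using S that by force
    moreover have "m j \<ge> 1" using nm that by auto
    ultimately have "S j \<noteq> {}" by auto
    then show ?thesis by blast
  qed
  have col: "i = j" if "x \<in> C i" "x \<in> C j" "1 \<le> i" "i \<le> k" "1 \<le> j" "j \<le> k" for x i j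
    using disjoint_family_onD[OF disj, of i j] that by auto
  have r_iff: "r a b \<longleftrightarrow> (a, b) \<in> R" for a b
  proof
    assume "r a b"
    then show "(a, b) \<in> R"
      unfolding r
    proof (induction rule: tranclp_induct)
      case (base y)
      then show ?case by (fastforce simp: R_def)
    next
      case (step y z)
      then obtain i j l where ij: "1 \<le> i" "i < j" "j \<le> k" "a \<in> C i" "y \<in> S j"
        and l: "l \<in> {1..<k}" "y \<in> C l" "z \<in> S (l + 1)" by (auto simp: R_def)
      have "y \<in> C j" using S_sub[of j] ij by (meson le_less_trans subsetD)
      then have "j = l" by (rule col[of y]) (use ij l in auto)
      then show ?case using ij l unfolding R_iff by (intro exI[of _ i] exI[of _ "l + 1"]) auto
    qed
  next
    assume "(a, b) \<in> R"
    then obtain i j where "1 \<le> i" "i < j" "j \<le> k" "a \<in> C i" "b \<in> S j" by (auto simp: R_def)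
    then show "r a b"
    proof (induction "j - i" arbitrary: j b)
      case (Suc d)
      show ?case
      proof (cases "j = i + 1")
        case True
        then show ?thesis unfolding r using Suc.prems by (intro tranclp.r_into_trancl) auto
      next
        case False
        then have j: "i + 1 < j" using Suc.prems by linarith
        have j1: "1 < j - 1" "j - 1 \<le> k" "d = j - 1 - i" "i < j - 1" "j - 1 + 1 = j" "j - 1 \<in> {1..<k}"
          using j Suc.prems Suc.hyps(2) by auto
        then obtain s where s: "s \<in> S (j - 1)" using S_ne by blast
        have "r a s" using j1 Suc.prems s by (intro Suc.hyps(1)[of "j - 1"])
        moreover have "s \<in> C (j - 1)" using S_sub j1 s by blast
        then have "\<exists>l\<in>{1..<k}. s \<in> C l \<and> b \<in> S (l + 1)"
          using j1 Suc.prems by (intro bexI[of _ "j - 1"]) simp_all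
        ultimately show ?thesis unfolding r by (rule tranclp.trancl_into_trancl)
      qed
    qed simp
  qed
  have ends: "arcs_ends Q = {(a, b). a \<in> P \<and> b \<in> P \<and> r a b \<and> a \<noteq> b \<and> \<not> (\<exists>t\<in>P - {a, b}. r a t \<and> r t b)}"
    using hasse unfolding hasse_quiver_def by blast
  have "arc_order Q = R"
  proof
    have "R = {(a, b). r a b}" using r_iff by auto
    then have "trans R" unfolding r by (auto intro!: transI dest: tranclp_trans)
    moreover have "arcs_ends Q \<subseteq> R" using r_iff unfolding ends by auto
    ultimately show "arc_order Q \<subseteq> R" unfolding arc_order_def
      by (metis subrelI trancl_id trancl_mono)
  next
    have "(a, b) \<in> arcs_ends Q" if i: "i \<in> {1..<k}" and a: "a \<in> C i" and b: "b \<in> S (i + 1)" for a b i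
    proof -
      have bC: "b \<in> C (i + 1)" using S_sub[of "i + 1"] i b by auto
      have "(a, b) \<in> R"
        unfolding R_iff using i a b by (intro exI[of _ i] exI[of _ "i + 1"]) auto
      then have "r a b" by (simp only: r_iff)
      moreover have "a \<noteq> b"
      proof
        assume "a = b"
        then have "i = i + 1" by (intro col[of a]) (use a bC i in auto)
        then show False by simp
      qed
      \<comment> \<open>A vertex between \<open>a\<close> and \<open>b\<close> would need a column
        strictly between the neighbouring columns \<open>i\<close> and \<open>i + 1\<close>.\<close>
      moreover have False if at: "r a t" and tb: "r t b" for t
      proof -
        obtain i1 j1 where 1: "1 \<le> i1" "i1 < j1" "j1 \<le> k" "a \<in> C i1" "t \<in> S j1"
          using at unfolding r_iff R_iff by blast
        obtain i2 j2 where 2: "1 \<le> i2" "i2 < j2" "j2 \<le> k" "t \<in> C i2" "b \<in> S j2"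
          using tb unfolding r_iff R_iff by blast
        have "t \<in> C j1" using S_sub[of j1] 1 by (meson le_less_trans subsetD)
        moreover have "b \<in> C j2" using S_sub[of j2] 2 by (meson le_less_trans subsetD)
        moreover have "i1 = i" by (rule col[of a]) (use 1 a i in auto)
        moreover have "j1 = i2" by (rule col[of t]) (use \<open>t \<in> C j1\<close> 1 2 in auto)
        moreover have "j2 = i + 1" by (rule col[of b]) (use \<open>b \<in> C j2\<close> bC 2 i in auto)
        ultimately show False using 1 2 by linarith
      qed
      moreover have "i \<in> {1..k}" "i + 1 \<in> {1..k}" using i by auto
      then have "a \<in> P" "b \<in> P" unfolding P using a bC by blast+
      ultimately show ?thesis unfolding ends by blast
    qed
    note arc = this
    have "(a, b) \<in> arc_order Q" if "r a b" for a b
      using that unfolding r arc_order_def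
    proof (induction rule: tranclp_induct)
      case (base y)
      then show ?case using arc by (blast intro: r_into_trancl)
    next
      case (step y z)
      then show ?case using arc by (blast intro: trancl_into_trancl)
    qed
    then show "R \<subseteq> arc_order Q" using r_iff by auto
  qed
  moreover have "layered R"
    unfolding layered_def
  proof (intro allI impI)
    fix a b b' c assume ab: "(a, b) \<in> R" "(b, c) \<in> R" "(a, b') \<in> R" "(b', c) \<in> R"
    have in_S: "\<exists>i. 1 < i \<and> i \<le> k \<and> y \<in> S i" if "(x, y) \<in> R" for x y
      using that unfolding R_iff by (meson le_less_trans)
    obtain i where b: "1 < i" "i \<le> k" "b \<in> S i" using in_S[OF ab(1)] by blast
    obtain j where b': "1 < j" "j \<le> k" "b' \<in> S j" using in_S[OF ab(3)] by blast
    have up: "(x, z) \<in> R \<longleftrightarrow> (\<exists>l. i < l \<and> l \<le> k \<and> z \<in> S l)"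
      and down: "(z, x) \<in> R \<longleftrightarrow> (\<exists>l. 1 \<le> l \<and> l < i \<and> z \<in> C l)"
      if i: "1 < i" "i \<le> k" and x: "x \<in> S i" for i x z
    proof -
      have xC: "x \<in> C i" using S_sub i x by blast
      show "(x, z) \<in> R \<longleftrightarrow> (\<exists>l. i < l \<and> l \<le> k \<and> z \<in> S l)"
      proof
        assume "(x, z) \<in> R"
        then obtain i' l where l: "1 \<le> i'" "i' < l" "l \<le> k" "x \<in> C i'" "z \<in> S l"
          unfolding R_iff by blast
        moreover have "i' = i" by (rule col[of x]) (use l xC i in auto)
        ultimately show "\<exists>l. i < l \<and> l \<le> k \<and> z \<in> S l" by blast
      next
        assume "\<exists>l. i < l \<and> l \<le> k \<and> z \<in> S l"
        moreover have "1 \<le> i" using i by simp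
        ultimately show "(x, z) \<in> R" using xC unfolding R_iff by blast
      qed
      show "(z, x) \<in> R \<longleftrightarrow> (\<exists>l. 1 \<le> l \<and> l < i \<and> z \<in> C l)"
      proof
        assume "(z, x) \<in> R"
        then obtain l j where l: "1 \<le> l" "l < j" "j \<le> k" "z \<in> C l" "x \<in> S j"
          unfolding R_iff by blast
        moreover have "x \<in> C j" using S_sub[of j] l by (meson le_less_trans subsetD)
        then have "j = i" by (rule col[of x]) (use l xC i in auto)
        ultimately show "\<exists>l. 1 \<le> l \<and> l < i \<and> z \<in> C l" by blast
      next
        assume "\<exists>l. 1 \<le> l \<and> l < i \<and> z \<in> C l"
        then show "(z, x) \<in> R" using i x unfolding R_iff by blast
      qed
    qed
    show "(b, b') \<in> R \<or> (b', b) \<in> R \<or> R `` {b} = R `` {b'} \<and> R\<inverse> `` {b} = R\<inverse> `` {b'}"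
    proof (rule linorder_cases[of i j])
      assume "i < j" then show ?thesis using up[OF b, of b'] b' by blast
    next
      assume "i > j" then show ?thesis using up[OF b', of b] b by blast
    next
      assume "i = j"
      then have "(b, z) \<in> R \<longleftrightarrow> (b', z) \<in> R" "(z, b) \<in> R \<longleftrightarrow> (z, b') \<in> R" for z
        using up[of i _ z] down[of i _ z] b b' by simp_all
      then show ?thesis by blast
    qed
  qed
  ultimately show ?thesis by simp
qed

text \<open>A walk with a repeated vertex contains a nonempty cycle, so in an acyclic quiver all
  walks are simple, and a finite digraph has finitely many simple paths.\<close>

lemma finite_paths:
  assumes "fin_digraph Q" and acyc: "acyclic (arcs_ends Q)"
  shows "finite (paths Q)"
proof -
  interpret fin_digraph Q by fact
  have "apath u p v" if walk: "awalk u p v" for u p v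
  proof (rule ccontr)
    assume "\<not> apath u p v"
    then have "\<not> distinct (awalk_verts u p)" using walk by (simp add: apath_def)
    then obtain r w where "awalk w r w" "r \<noteq> []"
      using awalk_not_distinct_decomp[OF walk] by (metis length_greater_0_conv)
    then have "(w, w) \<in> (arcs_ends Q)\<^sup>+" by (rule reachable1_awalkI)
    then show False using acyc by (auto simp: acyclic_def)
  qed
  then have "paths Q \<subseteq> (fst \<circ> snd) ` {(u, p, v). apath u p v}"
    by (force simp: paths_def)
  then show ?thesis by (rule finite_surj[OF apaths_finite_triple])
qed

section \<open>Orders generated by Hasse quivers\<close>

lemma hasse_quiver_ends:
  assumes "hasse_quiver P r Q"
  shows "arcs_ends Q =
    {(a, b). a \<in> P \<and> b \<in> P \<and> r a b \<and> a \<noteq> b \<and> \<not> (\<exists>t\<in>P - {a, b}. r a t \<and> r t b)}"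
  using assms unfolding hasse_quiver_def by blast

lemma hasse_quiver_arc_order:
  assumes "taos P r" and "hasse_quiver P r Q" and "(a, b) \<in> arc_order Q"
  shows "a \<in> P \<and> b \<in> P \<and> r a b"
proof -
  have tr: "r a c" if "a \<in> P" "b \<in> P" "c \<in> P" "r a b" "r b c" for a b c
    using assms(1) that unfolding taos_def by (blast dest: transp_onD)
  show ?thesis
    using assms(3) unfolding arc_order_def
    by (induction rule: trancl_induct) (auto simp: hasse_quiver_ends[OF assms(2)] intro: tr)
qed

text \<open>\<open>r\<close> may be reflexive, so irreflexivity is not at hand. Instead, an arrow
  with a path back would make its two ends equal by antisymmetry, while arrows join distinct
  vertices.\<close>

lemma hasse_quiver_acyclic:
  assumes "taos P r" and "hasse_quiver P r Q"
  shows "acyclic (arcs_ends Q)"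
proof -
  note ends = hasse_quiver_ends[OF assms(2)]
  have "a \<in> P \<and> b \<in> P \<and> r a b" if "(a, b) \<in> (arcs_ends Q)\<^sup>+" for a b
    using hasse_quiver_arc_order[OF assms] that by (simp add: arc_order_def)
  moreover have "antisymp_on P r" using assms(1) by (simp add: taos_def)
  ultimately have anti: "(b, a) \<notin> (arcs_ends Q)\<^sup>+" if "(a, b) \<in> arcs_ends Q" for a b
    using that unfolding ends antisymp_on_def by blast
  have "(a, a) \<notin> (arcs_ends Q)\<^sup>+" for a
  proof
    assume "(a, a) \<in> (arcs_ends Q)\<^sup>+"
    then obtain b where "(a, b) \<in> arcs_ends Q" "(b, a) \<in> (arcs_ends Q)\<^sup>*" by (blast dest: tranclD)
    moreover from this have "a \<noteq> b" unfolding ends by blast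
    ultimately show False using anti by (metis rtranclD)
  qed
  then show ?thesis by (simp add: acyclic_def)
qed

text \<open>By acyclicity \<open>b\<close> differs from \<open>a\<close> and \<open>c\<close>, so it
  is one of the intermediate elements that an arrow of the Hasse quiver forbids.\<close>

lemma hasse_quiver_no_bypass:
  assumes "taos P r" and "hasse_quiver P r Q"
    and "(a, b) \<in> arc_order Q" "(b, c) \<in> arc_order Q"
  shows "(a, c) \<notin> arcs_ends Q"
proof
  assume ac: "(a, c) \<in> arcs_ends Q"
  note ends = hasse_quiver_ends[OF assms(2)]
  note * = hasse_quiver_arc_order[OF assms(1,2)]
  have "acyclic (arcs_ends Q)" by (rule hasse_quiver_acyclic) fact+
  then have "a \<noteq> b" "b \<noteq> c" using assms(3,4) by (auto simp: arc_order_def acyclic_def)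
  then show False using ac *[OF assms(3)] *[OF assms(4)] by (auto simp: ends)
qed

lemma (in wf_digraph) awalk_arc_order:
  "(u, v) \<in> arc_order G \<longleftrightarrow> (\<exists>p. awalk u p v \<and> p \<noteq> [])"
  unfolding arc_order_def by (rule reachable1_awalk)

lemma arc_order_arcs:
  assumes "(u, v) \<in> (arcs_ends G)\<^sup>+"
  shows "\<exists>e\<in>arcs G. tail G e = u" "\<exists>e\<in>arcs G. head G e = v"
proof -
  obtain w where "(u, w) \<in> arcs_ends G" using assms by (meson tranclD)
  then show "\<exists>e\<in>arcs G. tail G e = u" by (auto simp: arcs_ends_conv)
  obtain w where "(w, v) \<in> arcs_ends G" using assms by (meson tranclD2)
  then show "\<exists>e\<in>arcs G. head G e = v" by (auto simp: arcs_ends_conv)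
qed

section \<open>The path algebra as a coordinate space\<close>

lemma path_algebra_simps:
  "carrier (path_algebra Q) = {x. finite {p. x p \<noteq> 0} \<and> {p. x p \<noteq> 0} \<subseteq> paths Q}"
  "zero (path_algebra Q) = (\<lambda>p. 0)"
  "add (path_algebra Q) x y = (\<lambda>p. x p + y p)"
  "c \<odot>\<^bsub>path_algebra Q\<^esub> x = (\<lambda>p. c * x p)"
  "(x \<otimes>\<^bsub>path_algebra Q\<^esub> y) r = (if r \<in> paths Q
      then \<Sum>(p, q) \<in> {(p, q). p \<in> paths Q \<and> q \<in> paths Q \<and> p @ q = r}. x p * y q else 0)"
  by (simp_all add: path_algebra_def)

lemma coordinatized_path_algebra:
  assumes "finite (paths Q)"
  shows "coordinatized (path_algebra Q) (paths Q) (\<lambda>x. x)"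
proof
  have "carrier (path_algebra Q) = {f. \<forall>i. i \<notin> paths Q \<longrightarrow> f i = 0}"
    using assms by (auto simp: path_algebra_simps intro: finite_subset)
  then show "bij_betw (\<lambda>x. x) (carrier (path_algebra Q)) {f. \<forall>i. i \<notin> paths Q \<longrightarrow> f i = 0}"
    by (simp add: bij_betw_def)
  show "x \<oplus>\<^bsub>path_algebra Q\<^esub> y \<in> carrier (path_algebra Q)"
    if "x \<in> carrier (path_algebra Q)" "y \<in> carrier (path_algebra Q)" for x y
  proof -
    have "{p. x p + y p \<noteq> 0} \<subseteq> {p. x p \<noteq> 0} \<union> {p. y p \<noteq> 0}" by auto
    then show ?thesis using that unfolding path_algebra_simps
      by (auto intro: finite_subset)
  qed
  show "c \<odot>\<^bsub>path_algebra Q\<^esub> x \<in> carrier (path_algebra Q)" if "x \<in> carrier (path_algebra Q)" for c x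
    using that unfolding path_algebra_simps by (auto intro: rev_finite_subset)
qed (use assms in \<open>auto simp: path_algebra_simps\<close>)

lemma path_vector_closed: "p \<in> paths Q \<Longrightarrow> path_vector p \<in> carrier (path_algebra Q)"
  by (simp add: path_algebra_simps path_vector_def)

lemma (in wf_digraph) arc_in_paths: "e \<in> arcs G \<Longrightarrow> [e] \<in> paths G"
  using arc_implies_awalk by (auto simp: paths_def)

section \<open>The order of a quiver and its algebraically connected components\<close>

context
  fixes Q :: "('v, 'e) pre_digraph" and Es
  assumes comps: "algebraically_connected_components Q Es"
    and wf: "wf_digraph Q" and fin: "finite (paths Q)"
begin

lemma component_subgraph: "E \<in> Es \<Longrightarrow> subgraph E Q"
  using comps by (simp add: algebraically_connected_components_def)

lemma component_ends:
  assumes "E \<in> Es"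
  shows "tail E = tail Q" "head E = head Q" "wf_digraph E" "arcs E \<subseteq> arcs Q"
  using component_subgraph[OF assms] by (auto simp: subgraph_def compatible_def)

text \<open>When the arrow, as a path of length one, is decomposed in the direct sum, some summand
  has a nonzero coefficient there; the component of that summand contains the arrow.\<close>

lemma arc_in_component:
  assumes "e \<in> arcs Q"
  obtains E where "E \<in> Es" "e \<in> arcs E"
proof -
  interpret wf_digraph Q by (rule wf)
  interpret A: coordinatized "path_algebra Q" "paths Q" "\<lambda>x. x"
    by (rule coordinatized_path_algebra) (rule fin)
  have "path_vector [e] \<in> carrier (path_algebra Q)"
    using assms by (intro path_vector_closed arc_in_paths)
  then obtain f where f: "f \<in> (\<Pi>\<^sub>E E\<in>Es. carrier (path_algebra E))"
    "path_vector [e] = (\<Oplus>\<^bsub>path_algebra Q\<^esub>E\<in>Es. f E)"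
    using comps unfolding algebraically_connected_components_def by blast
  have "f E \<in> carrier (path_algebra Q)" if "E \<in> Es" for E
  proof -
    have "paths E \<subseteq> paths Q"
      using subgraph_awalk_imp_awalk[OF _ component_subgraph[OF that]] unfolding paths_def by blast
    moreover have "f E \<in> carrier (path_algebra E)" using f(1) that by blast
    ultimately show ?thesis by (auto simp: path_algebra_simps)
  qed
  then have "path_vector [e] [e] = (\<Sum>E\<in>Es. f E [e])"
    unfolding f(2) by (rule A.coord_finsum(2))
  then have "(\<Sum>E\<in>Es. f E [e]) \<noteq> 0" by (simp add: path_vector_def)
  then obtain E where E: "E \<in> Es" "f E [e] \<noteq> 0" by (meson sum.neutral)
  then have "[e] \<in> paths E" using f(1) by (force simp: path_algebra_simps)
  then have "e \<in> arcs E" by (auto simp: paths_def pre_digraph.awalk_def)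
  with E that show thesis by blast
qed

text \<open>Elements of different components multiply to zero, whereas the product of two composable
  arrows has coefficient 1 at the path they form.\<close>

lemma composable_arcs_same_component:
  assumes E: "E \<in> Es" "e \<in> arcs E" and F: "F \<in> Es" "f \<in> arcs F" and ef: "head Q e = tail Q f"
  shows "E = F"
proof (rule ccontr)
  assume "E \<noteq> F"
  interpret wf_digraph Q by (rule wf)
  interpret E: wf_digraph E using component_ends E by blast
  interpret F: wf_digraph F using component_ends F by blast
  have ef_arcs: "e \<in> arcs Q" "f \<in> arcs Q" using component_ends E F by blast+
  have "path_vector [e] \<in> carrier (path_algebra E)" "path_vector [f] \<in> carrier (path_algebra F)"
    using E F by (auto intro!: path_vector_closed E.arc_in_paths F.arc_in_paths)
  then have "path_vector [e] \<otimes>\<^bsub>path_algebra Q\<^esub> path_vector [f] = \<zero>\<^bsub>path_algebra Q\<^esub>"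
    using comps \<open>E \<noteq> F\<close> E F unfolding algebraically_connected_components_def by blast
  then have z: "(path_vector [e] \<otimes>\<^bsub>path_algebra Q\<^esub> path_vector [f]) [e, f] = 0"
    by (simp add: path_algebra_simps)
  have "awalk (tail Q e) [e, f] (head Q f)"
    using ef_arcs ef by (simp add: awalk_simps)
  then have ef_path: "[e, f] \<in> paths Q" by (auto simp: paths_def)
  \<comment> \<open>Paths are nonempty, so a path of two arrows can be cut in only one way.\<close>
  have "{(p, q). p \<in> paths Q \<and> q \<in> paths Q \<and> p @ q = [e, f]} = {([e], [f])}"
  proof -
    have "p @ q = [e, f] \<longleftrightarrow> (p, q) = ([e], [f])" if "p \<in> paths Q" "q \<in> paths Q" for p q
      using that by (auto simp: paths_def append_eq_Cons_conv)
    then show ?thesis using arc_in_paths ef_arcs by auto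
  qed
  then show False using z ef_path by (simp add: path_algebra_simps path_vector_def)
qed

text \<open>All arrows at the inner vertex \<open>b\<close> lie in one component, since they are pairwise composable or
  composable with a common arrow.\<close>

lemma inner_vertex_component:
  assumes ab: "(a, b) \<in> arc_order Q" and bc: "(b, c) \<in> arc_order Q"
  obtains E where "E \<in> Es" "\<And>x. (x, b) \<in> arc_order Q \<longleftrightarrow> (x, b) \<in> arc_order E"
    "\<And>x. (b, x) \<in> arc_order Q \<longleftrightarrow> (b, x) \<in> arc_order E"
proof -
  have mono: "arc_order E \<subseteq> arc_order Q" if "E \<in> Es" for E
    unfolding arc_order_def using component_ends[OF that]
    by (intro trancl_mono_subset) (auto simp: arcs_ends_conv)
  \<comment> \<open>Once an arrow of \<open>E\<close> ends at \<open>b\<close>, composability hands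
    membership in \<open>E\<close> on along every path that starts at \<open>b\<close>.\<close>
  have up: "(b, y) \<in> arc_order E"
    if E: "E \<in> Es" "e \<in> arcs E" "head Q e = b" and y: "(b, y) \<in> arc_order Q" for E e b y
    using y unfolding arc_order_def
  proof (induction rule: trancl_induct)
    case (base y)
    then obtain f where f: "f \<in> arcs Q" "tail Q f = b" "head Q f = y" by (auto simp: arcs_ends_conv)
    obtain F where F: "F \<in> Es" "f \<in> arcs F" using arc_in_component[OF f(1)] by blast
    have "E = F" using composable_arcs_same_component[OF E(1,2) F] E(3) f by simp
    then show ?case using F f component_ends[OF E(1)] by (auto simp: arcs_ends_conv intro!: r_into_trancl)
  next
    case (step y z)
    then obtain f where f: "f \<in> arcs Q" "tail Q f = y" "head Q f = z" by (auto simp: arcs_ends_conv)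
    obtain F where F: "F \<in> Es" "f \<in> arcs F" using arc_in_component[OF f(1)] by blast
    obtain g where g: "g \<in> arcs E" "head Q g = y"
      using arc_order_arcs(2)[OF step(3)] component_ends[OF E(1)] by auto
    have "E = F" using composable_arcs_same_component[OF E(1) g(1) F] g f by simp
    then have "(y, z) \<in> arcs_ends E" using F f component_ends[OF E(1)] by (auto simp: arcs_ends_conv)
    with step(3) show ?case by (rule trancl_into_trancl)
  qed
  have down: "(y, b) \<in> arc_order E"
    if E: "E \<in> Es" "e \<in> arcs E" "tail Q e = b" and y: "(y, b) \<in> arc_order Q" for E e b y
    using y unfolding arc_order_def
  proof (induction rule: converse_trancl_induct)
    case (base y)
    then obtain f where f: "f \<in> arcs Q" "tail Q f = y" "head Q f = b" by (auto simp: arcs_ends_conv)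
    obtain F where F: "F \<in> Es" "f \<in> arcs F" using arc_in_component[OF f(1)] by blast
    have "F = E" using composable_arcs_same_component[OF F E(1,2)] E(3) f by simp
    then show ?case using F f component_ends[OF E(1)] by (auto simp: arcs_ends_conv intro!: r_into_trancl)
  next
    case (step z y)
    then obtain f where f: "f \<in> arcs Q" "tail Q f = z" "head Q f = y" by (auto simp: arcs_ends_conv)
    obtain F where F: "F \<in> Es" "f \<in> arcs F" using arc_in_component[OF f(1)] by blast
    obtain g where g: "g \<in> arcs E" "tail Q g = y"
      using arc_order_arcs(1)[OF step(3)] component_ends[OF E(1)] by auto
    have "F = E" using composable_arcs_same_component[OF F E(1) g(1)] g f by simp
    then have "(z, y) \<in> arcs_ends E" using F f component_ends[OF E(1)] by (auto simp: arcs_ends_conv)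
    then show ?case using step(3) by (rule trancl_into_trancl2)
  qed
  obtain e where e: "e \<in> arcs Q" "head Q e = b"
    using ab arc_order_arcs(2) unfolding arc_order_def by metis
  obtain E where E: "E \<in> Es" "e \<in> arcs E" using arc_in_component[OF e(1)] by blast
  have "(b, c) \<in> arc_order E" by (rule up[OF E e(2) bc])
  \<comment> \<open>\<open>down\<close> needs an arrow of the same component that leaves
    \<open>b\<close>.\<close>
  then obtain f where f: "f \<in> arcs E" "tail Q f = b"
    using arc_order_arcs(1) component_ends[OF E(1)] unfolding arc_order_def by metis
  show thesis
    by (rule that[OF E(1)]) (use up[OF E e(2)] down[OF E(1) f] mono[OF E(1)] in blast)+
qed

text \<open>Two vertices between \<open>a\<close> and \<open>c\<close> give paths of length at least
  two from \<open>a\<close> to \<open>c\<close> in their components. By \<open>no_parallel\<close>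
  these components coincide, and what lies above or below the two vertices is found inside this
  one.\<close>

lemma components_layered:
  assumes layered: "\<And>E. E \<in> Es \<Longrightarrow> layered (arc_order E)"
    and no_parallel: "\<forall>E\<in>Es. \<forall>F\<in>Es. E \<noteq> F \<longrightarrow>
          \<not> (\<exists>u v p q. pre_digraph.awalk E u p v \<and> length p \<ge> 2 \<and>
               pre_digraph.awalk F u q v \<and> length q \<ge> 2)"
  shows "layered (arc_order Q)"
  unfolding layered_def
proof (intro allI impI)
  fix a b b' c
  assume ab: "(a, b) \<in> arc_order Q" and bc: "(b, c) \<in> arc_order Q"
    and ab': "(a, b') \<in> arc_order Q" and bc': "(b', c) \<in> arc_order Q"
  have long: "\<exists>p. pre_digraph.awalk E a p c \<and> length p \<ge> 2"
    if E: "E \<in> Es" and abc: "(a, b) \<in> arc_order E" "(b, c) \<in> arc_order E" for E b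
  proof -
    interpret E: wf_digraph E using component_ends E by blast
    obtain p q where "E.awalk a p b" "p \<noteq> []" "E.awalk b q c" "q \<noteq> []"
      using abc unfolding E.awalk_arc_order by blast
    then have "E.awalk a (p @ q) c" "length (p @ q) \<ge> 2"
      by (auto simp: neq_Nil_conv intro: E.awalk_appendI)
    then show ?thesis by blast
  qed
  obtain E where E: "E \<in> Es" "\<And>x. (x, b) \<in> arc_order Q \<longleftrightarrow> (x, b) \<in> arc_order E"
    "\<And>x. (b, x) \<in> arc_order Q \<longleftrightarrow> (b, x) \<in> arc_order E"
    using inner_vertex_component[OF ab bc] by metis
  obtain F where F: "F \<in> Es" "\<And>x. (x, b') \<in> arc_order Q \<longleftrightarrow> (x, b') \<in> arc_order F"
    "\<And>x. (b', x) \<in> arc_order Q \<longleftrightarrow> (b', x) \<in> arc_order F"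
    using inner_vertex_component[OF ab' bc'] by metis
  have "E = F"
    using no_parallel long[of E b] long[of F b'] E F ab bc ab' bc' by blast
  moreover have "(b, b') \<in> arc_order E \<or> (b', b) \<in> arc_order E \<or>
      arc_order E `` {b} = arc_order E `` {b'} \<and> (arc_order E)\<inverse> `` {b} = (arc_order E)\<inverse> `` {b'}"
    by (rule layeredD[OF layered[OF E(1)], of a b c]) (use ab bc ab' bc' E F \<open>E = F\<close> in auto)
  moreover have "arc_order Q `` {b} = arc_order E `` {b}" "arc_order Q `` {b'} = arc_order F `` {b'}"
    "(arc_order Q)\<inverse> `` {b} = (arc_order E)\<inverse> `` {b}" "(arc_order Q)\<inverse> `` {b'} = (arc_order F)\<inverse> `` {b'}"
    using E F by auto
  ultimately show "(b, b') \<in> arc_order Q \<or> (b', b) \<in> arc_order Q \<or>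
      arc_order Q `` {b} = arc_order Q `` {b'} \<and> (arc_order Q)\<inverse> `` {b} = (arc_order Q)\<inverse> `` {b'}"
    using E F by metis
qed

end

section \<open>Quotient algebras in coordinates\<close>

text \<open>The homomorphism theorem in coordinates: \<open>\<phi>\<close> is onto the functions
  supported in \<open>K\<close> but may have a kernel, and the quotient by that kernel has these
  functions as coordinates.\<close>

locale algebra_coordinates =
  fixes A :: "(real, 'a) module" (structure) and K :: "'i set" and \<phi> :: "'a \<Rightarrow> 'i \<Rightarrow> real"
    and m :: "('i \<Rightarrow> real) \<Rightarrow> ('i \<Rightarrow> real) \<Rightarrow> 'i \<Rightarrow> real"
  assumes vs: "vectorspace class_ring A" and finite_K: "finite K"
    and image_coord: "\<phi> ` carrier A = {f. \<forall>i. i \<notin> K \<longrightarrow> f i = 0}"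
    and coord_add: "x \<in> carrier A \<Longrightarrow> y \<in> carrier A \<Longrightarrow> \<phi> (x \<oplus> y) = (\<lambda>i. \<phi> x i + \<phi> y i)"
    and coord_smult: "x \<in> carrier A \<Longrightarrow> \<phi> (c \<odot>\<^bsub>A\<^esub> x) = (\<lambda>i. c * \<phi> x i)"
    and mult_closed: "x \<in> carrier A \<Longrightarrow> y \<in> carrier A \<Longrightarrow> x \<otimes> y \<in> carrier A"
    and coord_mult: "x \<in> carrier A \<Longrightarrow> y \<in> carrier A \<Longrightarrow> \<phi> (x \<otimes> y) = m (\<phi> x) (\<phi> y)"
begin

sublocale A: vectorspace class_ring A by (rule vs)

definition kernel :: "'a set" where
  "kernel = {x \<in> carrier A. \<phi> x = (\<lambda>i. 0)}"

definition fibre :: "('i \<Rightarrow> real) \<Rightarrow> 'a set" where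
  "fibre f = {x \<in> carrier A. \<phi> x = f}"

abbreviation supported :: "('i \<Rightarrow> real) set" where
  "supported \<equiv> {f. \<forall>i. i \<notin> K \<longrightarrow> f i = 0}"

lemma coord_supported: "x \<in> carrier A \<Longrightarrow> \<phi> x \<in> supported"
  using image_coord by blast

lemma fibre_nonempty:
  assumes "f \<in> supported"
  obtains x where "x \<in> carrier A" "\<phi> x = f"
proof -
  have "f \<in> \<phi> ` carrier A" using assms unfolding image_coord .
  then show thesis using that by blast
qed

lemma coord_zero: "\<phi> \<zero> = (\<lambda>i. 0)"
proof
  fix i
  have "\<phi> (\<zero> \<oplus> \<zero>) i = \<phi> \<zero> i + \<phi> \<zero> i" by (simp add: coord_add del: A.add.r_one A.add.l_one)
  then show "\<phi> \<zero> i = 0" by simp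
qed

lemma coord_minus:
  assumes "x \<in> carrier A" "y \<in> carrier A"
  shows "\<phi> (x \<ominus> y) = (\<lambda>i. \<phi> x i - \<phi> y i)"
proof
  fix i
  have "x = (x \<ominus> y) \<oplus> y" using assms by (simp add: a_minus_def A.add.m_assoc A.l_neg)
  then have "\<phi> x i = \<phi> (x \<ominus> y) i + \<phi> y i" using assms by (metis A.minus_closed coord_add)
  then show "\<phi> (x \<ominus> y) i = \<phi> x i - \<phi> y i" by simp
qed

lemma add_minus:
  assumes "x \<in> carrier A" "y \<in> carrier A"
  shows "x \<oplus> (y \<ominus> x) = y"
proof -
  have "x \<oplus> (y \<ominus> x) = (y \<ominus> x) \<oplus> x" using assms by (intro A.a_comm) auto
  also have "\<dots> = y \<oplus> (\<ominus> x \<oplus> x)" unfolding a_minus_def using assms by (intro A.a_assoc) auto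
  also have "\<dots> = y" using assms by (simp add: A.l_neg)
  finally show ?thesis .
qed

lemma coset_eq_fibre:
  assumes x: "x \<in> carrier A"
  shows "kernel +> x = fibre (\<phi> x)"
proof
  show "kernel +> x \<subseteq> fibre (\<phi> x)"
    using x by (auto simp: a_r_coset_def' kernel_def fibre_def coord_add)
  show "fibre (\<phi> x) \<subseteq> kernel +> x"
  proof
    fix y assume "y \<in> fibre (\<phi> x)"
    then have y: "y \<in> carrier A" "\<phi> y = \<phi> x" by (auto simp: fibre_def)
    then have "y \<ominus> x \<in> kernel" using x by (simp add: kernel_def coord_minus)
    moreover have "(y \<ominus> x) \<oplus> x = y" using add_minus x y by (metis A.a_comm A.minus_closed)
    ultimately show "y \<in> kernel +> x" by (force simp: a_r_coset_def')
  qed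
qed

abbreviation Factor :: "(real, 'a set) module" where
  "Factor \<equiv> quotient_algebra A kernel"

text \<open>The choice of the representative does not matter, as \<open>\<phi>\<close> is constant
  on each coset of \<open>kernel\<close>.\<close>

definition class_coord :: "'a set \<Rightarrow> 'i \<Rightarrow> real" where
  "class_coord X = \<phi> (SOME x. x \<in> X)"

lemma class_coord_fibre:
  assumes "f \<in> supported"
  shows "class_coord (fibre f) = f"
proof -
  obtain x where "x \<in> fibre f" using fibre_nonempty[OF assms] by (auto simp: fibre_def)
  then have "(SOME x. x \<in> fibre f) \<in> fibre f" by (rule someI)
  then show ?thesis by (simp add: class_coord_def fibre_def)
qed

lemma carrier_Factor: "carrier Factor = fibre ` supported"
proof -
  have "carrier Factor = (\<lambda>x. fibre (\<phi> x)) ` carrier A"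
    by (auto simp: quotient_algebra_def A_RCOSETS_def' coset_eq_fibre)
  also have "\<dots> = fibre ` supported" unfolding image_coord[symmetric] by auto
  finally show ?thesis .
qed

lemma zero_Factor: "\<zero>\<^bsub>Factor\<^esub> = fibre (\<lambda>i. 0)"
  by (simp add: quotient_algebra_def kernel_def fibre_def)

lemma add_Factor:
  assumes f: "f \<in> supported" and g: "g \<in> supported"
  shows "fibre f \<oplus>\<^bsub>Factor\<^esub> fibre g = fibre (\<lambda>i. f i + g i)"
proof -
  have "fibre f \<oplus>\<^bsub>Factor\<^esub> fibre g = (\<Union>x\<in>fibre f. \<Union>y\<in>fibre g. {x \<oplus> y})"
    by (simp add: quotient_algebra_def set_add_def')
  also have "\<dots> = fibre (\<lambda>i. f i + g i)"
  proof
    show "(\<Union>x\<in>fibre f. \<Union>y\<in>fibre g. {x \<oplus> y}) \<subseteq> fibre (\<lambda>i. f i + g i)"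
      by (auto simp: fibre_def coord_add)
    \<comment> \<open>With one \<open>x\<close> over \<open>f\<close> fixed, every \<open>z\<close>
      over the sum splits as \<open>x\<close> plus \<open>z\<close> minus \<open>x\<close>.\<close>
    obtain x where x: "x \<in> carrier A" "\<phi> x = f" using fibre_nonempty[OF f] .
    show "fibre (\<lambda>i. f i + g i) \<subseteq> (\<Union>x\<in>fibre f. \<Union>y\<in>fibre g. {x \<oplus> y})"
    proof
      fix z assume "z \<in> fibre (\<lambda>i. f i + g i)"
      then have z: "z \<in> carrier A" "\<phi> z = (\<lambda>i. f i + g i)" by (auto simp: fibre_def)
      then have "z \<ominus> x \<in> fibre g" using x by (simp add: fibre_def coord_minus)
      moreover have "x \<in> fibre f" "z = x \<oplus> (z \<ominus> x)" using x z add_minus by (simp_all add: fibre_def)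
      ultimately show "z \<in> (\<Union>x\<in>fibre f. \<Union>y\<in>fibre g. {x \<oplus> y})" by blast
    qed
  qed
  finally show ?thesis .
qed

lemma smult_Factor:
  assumes f: "f \<in> supported"
  shows "c \<odot>\<^bsub>Factor\<^esub> fibre f = fibre (\<lambda>i. c * f i)"
proof -
  have "c \<odot>\<^bsub>Factor\<^esub> fibre f = (\<Union>x\<in>fibre f. kernel +> (c \<odot>\<^bsub>A\<^esub> x))"
    by (simp add: quotient_algebra_def)
  also have "\<dots> = (\<Union>x\<in>fibre f. fibre (\<lambda>i. c * f i))"
    by (intro SUP_cong refl) (simp add: fibre_def[of f] coset_eq_fibre coord_smult)
  also have "\<dots> = fibre (\<lambda>i. c * f i)"
  proof -
    \<comment> \<open>Operations of the quotient are unions over representatives; a union of equal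
      sets is that set only if there is a representative.\<close>
    obtain x where "x \<in> carrier A" "\<phi> x = f" by (rule fibre_nonempty[OF f])
    then have "fibre f \<noteq> {}" by (auto simp: fibre_def)
    then show ?thesis by simp
  qed
  finally show ?thesis .
qed

lemma mult_Factor:
  assumes f: "f \<in> supported" and g: "g \<in> supported"
  shows "fibre f \<otimes>\<^bsub>Factor\<^esub> fibre g = fibre (m f g)"
proof -
  have "fibre f \<otimes>\<^bsub>Factor\<^esub> fibre g = (\<Union>x\<in>fibre f. \<Union>y\<in>fibre g. kernel +> (x \<otimes> y))"
    by (simp add: quotient_algebra_def rcoset_mult_def)
  also have "\<dots> = (\<Union>x\<in>fibre f. \<Union>y\<in>fibre g. fibre (m f g))"
    by (intro SUP_cong refl) (simp add: fibre_def[of f] fibre_def[of g] coset_eq_fibre coord_mult mult_closed)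
  also have "\<dots> = fibre (m f g)"
  proof -
    obtain x where "x \<in> carrier A" "\<phi> x = f" by (rule fibre_nonempty[OF f])
    moreover obtain y where "y \<in> carrier A" "\<phi> y = g" by (rule fibre_nonempty[OF g])
    ultimately have "fibre f \<noteq> {}" "fibre g \<noteq> {}" by (auto simp: fibre_def)
    then show ?thesis by simp
  qed
  finally show ?thesis .
qed

lemma mult_supported:
  assumes f: "f \<in> supported" and g: "g \<in> supported"
  shows "m f g \<in> supported"
proof -
  obtain x where x: "x \<in> carrier A" "\<phi> x = f" by (rule fibre_nonempty[OF f])
  obtain y where y: "y \<in> carrier A" "\<phi> y = g" by (rule fibre_nonempty[OF g])
  show ?thesis using coord_supported[OF mult_closed[OF x(1) y(1)]] by (simp only: coord_mult x y)
qed

lemma coordinatized_Factor: "coordinatized Factor K class_coord"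
proof
  show "bij_betw class_coord (carrier Factor) supported"
    unfolding carrier_Factor
    by (rule bij_betw_byWitness[where f' = fibre]) (use class_coord_fibre in auto)
  show "finite K" by (rule finite_K)
  fix x y assume "x \<in> carrier Factor" "y \<in> carrier Factor"
  then obtain f g where f: "f \<in> supported" "x = fibre f" and g: "g \<in> supported" "y = fibre g"
    unfolding carrier_Factor by blast
  have fg: "(\<lambda>i. f i + g i) \<in> supported" using f g by simp
  show "x \<oplus>\<^bsub>Factor\<^esub> y \<in> carrier Factor"
    unfolding f(2) g(2) add_Factor[OF f(1) g(1)] carrier_Factor using fg by blast
  show "class_coord (x \<oplus>\<^bsub>Factor\<^esub> y) i = class_coord x i + class_coord y i" for i
    unfolding f(2) g(2) add_Factor[OF f(1) g(1)]
    by (simp only: class_coord_fibre f(1) g(1) fg)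
next
  fix x c assume "x \<in> carrier Factor"
  then obtain f where f: "f \<in> supported" "x = fibre f"
    unfolding carrier_Factor by blast
  have cf: "(\<lambda>i. c * f i) \<in> supported" using f by simp
  show "c \<odot>\<^bsub>Factor\<^esub> x \<in> carrier Factor"
    unfolding f(2) smult_Factor[OF f(1)] carrier_Factor using cf by blast
  show "class_coord (c \<odot>\<^bsub>Factor\<^esub> x) i = c * class_coord x i" for i
    unfolding f(2) smult_Factor[OF f(1)] by (simp only: class_coord_fibre f(1) cf)
next
  have z: "(\<lambda>i. 0) \<in> supported" by simp
  show "\<zero>\<^bsub>Factor\<^esub> \<in> carrier Factor" unfolding zero_Factor carrier_Factor using z by blast
  show "class_coord \<zero>\<^bsub>Factor\<^esub> i = 0" for i unfolding zero_Factor class_coord_fibre[OF z] ..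
qed

lemma Factor_mult:
  assumes "x \<in> carrier Factor" "y \<in> carrier Factor"
  shows "x \<otimes>\<^bsub>Factor\<^esub> y \<in> carrier Factor" "class_coord (x \<otimes>\<^bsub>Factor\<^esub> y) = m (class_coord x) (class_coord y)"
proof -
  obtain f where f: "f \<in> supported" "x = fibre f" using assms(1) unfolding carrier_Factor by blast
  obtain g where g: "g \<in> supported" "y = fibre g" using assms(2) unfolding carrier_Factor by blast
  have fg: "m f g \<in> supported" by (rule mult_supported[OF f(1) g(1)])
  show "x \<otimes>\<^bsub>Factor\<^esub> y \<in> carrier Factor"
    unfolding f(2) g(2) mult_Factor[OF f(1) g(1)] carrier_Factor using fg by blast
  show "class_coord (x \<otimes>\<^bsub>Factor\<^esub> y) = m (class_coord x) (class_coord y)"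
    unfolding f(2) g(2) mult_Factor[OF f(1) g(1)] by (simp only: class_coord_fibre f(1) g(1) fg)
qed

abbreviation Lie :: "(real, 'a set) module" where
  "Lie \<equiv> commutator_lie_algebra Factor"

text \<open>The Jacobi identity follows from associativity and the two difference laws of
  \<open>m\<close>, so it need not be checked on structure constants.\<close>

lemma coordinatized_lie_algebra_quotient:
  assumes m_assoc: "\<And>f g h. m (m f g) h = m f (m g h)"
    and m_diff: "\<And>f g h. m (\<lambda>i. f i - g i) h = (\<lambda>i. m f h i - m g h i)"
      "\<And>f g h. m h (\<lambda>i. f i - g i) = (\<lambda>i. m h f i - m h g i)"
    and C: "\<And>f g k. k \<in> K \<Longrightarrow> m f g k - m g f k = (\<Sum>i\<in>K. \<Sum>j\<in>K. C i j k * f i * g j)"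
    and antisym: "\<And>i j k. C i j k = - C j i k"
  shows "coordinatized_lie_algebra Lie K class_coord C"
proof -
  interpret Q: coordinatized Factor K class_coord by (rule coordinatized_Factor)
  have car: "carrier Lie = carrier Factor" "add Lie = add Factor" "zero Lie = zero Factor"
    "module.smult Lie = module.smult Factor"
    by (simp_all add: commutator_lie_algebra_def)
  have brk: "x \<otimes>\<^bsub>Lie\<^esub> y = (x \<otimes>\<^bsub>Factor\<^esub> y) \<ominus>\<^bsub>Factor\<^esub> (y \<otimes>\<^bsub>Factor\<^esub> x)" for x y
    by (simp add: commutator_lie_algebra_def)
  have closed: "x \<otimes>\<^bsub>Lie\<^esub> y \<in> carrier Factor" if "x \<in> carrier Factor" "y \<in> carrier Factor" for x y
    unfolding brk using that by (intro Q.coord_minus Factor_mult)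
  have coord: "class_coord (x \<otimes>\<^bsub>Lie\<^esub> y) =
      (\<lambda>i. m (class_coord x) (class_coord y) i - m (class_coord y) (class_coord x) i)"
    if "x \<in> carrier Factor" "y \<in> carrier Factor" for x y
    unfolding brk using that by (auto simp: Q.coord_minus Factor_mult)
  \<comment> \<open>Passing to the commutator changes only the multiplication, which
    \<open>coordinatized\<close> does not mention.\<close>
  interpret L: coordinatized Lie K class_coord
    unfolding coordinatized_def car using coordinatized_Factor unfolding coordinatized_def .
  show ?thesis
  proof
    fix x y assume xy: "x \<in> carrier Lie" "y \<in> carrier Lie"
    then show "x \<otimes>\<^bsub>Lie\<^esub> y \<in> carrier Lie" unfolding car by (rule closed)
    show "class_coord (x \<otimes>\<^bsub>Lie\<^esub> y) k = (\<Sum>i\<in>K. \<Sum>j\<in>K. C i j k * class_coord x i * class_coord y j)"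
      if "k \<in> K" for k
      using xy C[OF that] unfolding car by (simp add: coord)
  next
    fix x y z assume "x \<in> carrier Lie" "y \<in> carrier Lie" "z \<in> carrier Lie"
    then show "x \<otimes>\<^bsub>Lie\<^esub> (y \<otimes>\<^bsub>Lie\<^esub> z) \<oplus>\<^bsub>Lie\<^esub> y \<otimes>\<^bsub>Lie\<^esub> (z \<otimes>\<^bsub>Lie\<^esub> x) \<oplus>\<^bsub>Lie\<^esub> z \<otimes>\<^bsub>Lie\<^esub> (x \<otimes>\<^bsub>Lie\<^esub> y) = \<zero>\<^bsub>Lie\<^esub>"
      unfolding car
      by (intro Q.coord_eqI)
        (simp_all add: closed Q.add_closed Q.zero_closed Q.coord_add Q.coord_zero coord m_diff m_assoc)
  qed (rule antisym)
qed

end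

lemma (in algebra_coordinates) kernel_algebra_ideal:
  assumes "\<And>f. m f (\<lambda>i. 0) = (\<lambda>i. 0)" "\<And>f. m (\<lambda>i. 0) f = (\<lambda>i. 0)"
  shows "algebra_ideal A kernel"
proof -
  have "Module.submodule kernel class_ring A"
  proof (rule A.submoduleI)
    show "\<ominus> x \<in> kernel" if x: "x \<in> kernel" for x
    proof -
      have x': "x \<in> carrier A" "\<phi> x = (\<lambda>i. 0)" using x by (auto simp: kernel_def)
      have "\<phi> (\<ominus> x \<oplus> x) = \<phi> \<zero>" using x'(1) by (simp only: A.l_neg)
      then have "\<phi> (\<ominus> x) = (\<lambda>i. 0)" using x' coord_add[OF A.a_inv_closed[OF x'(1)] x'(1)] coord_zero by simp
      then show ?thesis using x' by (simp add: kernel_def)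
    qed
  qed (auto simp: kernel_def coord_zero coord_add coord_smult)
  then show ?thesis
    using assms by (auto simp: algebra_ideal_def kernel_def mult_closed coord_mult)
qed

section \<open>The path algebra with extra arrows\<close>

lemma (in wf_digraph) awalk_ends_hd_last:
  "awalk u p v \<Longrightarrow> p \<noteq> [] \<Longrightarrow> tail G (hd p) = u \<and> head G (last p) = v"
  by (induction p arbitrary: u) (auto simp: awalk_simps)

text \<open>Both alternatives of the theorem lead here: beyond acyclicity and simplicity of
  \<open>Q\<close>, only \<open>no_bypass\<close> and \<open>layered\<close> are retained.\<close>

locale thickened_quiver =
  fixes Q Q' :: "('v, 'e) pre_digraph"
  assumes fin: "fin_digraph Q'" and span: "spanning Q Q'" and nomulti: "nomulti_digraph Q"
    and acyc: "acyclic (arcs_ends Q)"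
    and parallel: "\<forall>e\<in>arcs Q' - arcs Q. \<exists>f\<in>arcs Q. tail Q' e = tail Q f \<and> head Q' e = head Q f"
    and no_bypass: "(a, b) \<in> arc_order Q \<Longrightarrow> (b, c) \<in> arc_order Q \<Longrightarrow> (a, c) \<notin> arcs_ends Q"
    and layered: "layered (arc_order Q)"
begin

sublocale Q': fin_digraph Q' by (rule fin)
sublocale Q: nomulti_digraph Q by (rule nomulti)

abbreviation R :: "('v \<times> 'v) set" where "R \<equiv> arc_order Q"

abbreviation E :: "'e set" where "E \<equiv> arcs Q' - arcs Q"

lemma ends_eq: "tail Q' = tail Q" "head Q' = head Q" "arcs Q \<subseteq> arcs Q'" "verts Q' = verts Q"
  using span by (auto simp: spanning_def subgraph_def compatible_def)

lemma subgraph_Q: "subgraph Q Q'"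
  using span by (simp add: spanning_def)

text \<open>Extra arrows run parallel to original ones, so they leave the order unchanged.\<close>

lemma arcs_ends_eq: "arcs_ends Q' = arcs_ends Q"
proof
  show "arcs_ends Q \<subseteq> arcs_ends Q'" using ends_eq by (auto simp: arcs_ends_conv)
  show "arcs_ends Q' \<subseteq> arcs_ends Q"
  proof
    fix x assume "x \<in> arcs_ends Q'"
    then obtain e where e: "e \<in> arcs Q'" "x = (tail Q e, head Q e)"
      using ends_eq by (auto simp: arcs_ends_conv)
    show "x \<in> arcs_ends Q"
    proof (cases "e \<in> arcs Q")
      case False
      then obtain f where "f \<in> arcs Q" "tail Q' e = tail Q f" "head Q' e = head Q f"
        using parallel e by blast
      then show ?thesis using e ends_eq by (auto simp: arcs_ends_conv)
    qed (use e in \<open>auto simp: arcs_ends_conv\<close>)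
  qed
qed

lemma arc_order_eq: "arc_order Q' = R"
  by (simp add: arc_order_def arcs_ends_eq)

lemma finite_paths_Q': "finite (paths Q')"
  by (rule finite_paths) (use fin acyc arcs_ends_eq in auto)

sublocale layered_order R
proof
  have "R \<subseteq> verts Q' \<times> verts Q'"
  proof (rule subrelI)
    fix a b assume "(a, b) \<in> R"
    then obtain p where "Q'.awalk a p b" unfolding arc_order_eq[symmetric] Q'.awalk_arc_order by blast
    then show "(a, b) \<in> verts Q' \<times> verts Q'"
      by (auto dest: Q'.awalk_hd_in_verts Q'.awalk_last_in_verts)
  qed
  then show "finite R" by (rule finite_subset) simp
  show "trans R" by (simp add: arc_order_def)
  show "(a, a) \<notin> R" for a using acyc by (simp add: arc_order_def acyclic_def)
  show "layered R" by (rule layered)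
qed

section \<open>Walks of positive length between two vertices\<close>

definition walks :: "'v \<Rightarrow> 'v \<Rightarrow> 'e list set" where
  "walks a b = {p. Q'.awalk a p b \<and> p \<noteq> []}"

definition source :: "'e list \<Rightarrow> 'v" where "source p = tail Q' (hd p)"

definition target :: "'e list \<Rightarrow> 'v" where "target p = head Q' (last p)"

lemma walks_iff: "p \<in> walks a b \<longleftrightarrow> p \<in> paths Q' \<and> source p = a \<and> target p = b"
proof -
  have "p \<in> walks a b \<Longrightarrow> source p = a \<and> target p = b" for a b
    using Q'.awalk_ends_hd_last by (auto simp: walks_def source_def target_def)
  moreover have "p \<in> paths Q' \<longleftrightarrow> (\<exists>u v. p \<in> walks u v)"
    by (auto simp: paths_def walks_def)
  ultimately show ?thesis by blast
qed

lemma finite_walks [simp]: "finite (walks a b)"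
  using finite_paths_Q' by (rule rev_finite_subset) (auto simp: walks_iff)

lemma R_iff_walks: "(a, b) \<in> R \<longleftrightarrow> walks a b \<noteq> {}"
  unfolding arc_order_eq[symmetric] Q'.awalk_arc_order by (auto simp: walks_def)

lemma path_ends_R:
  assumes "p \<in> paths Q'"
  shows "(source p, target p) \<in> R"
proof -
  have "p \<in> walks (source p) (target p)" using assms by (simp add: walks_iff)
  then show ?thesis unfolding R_iff_walks by blast
qed

lemma append_walks:
  "p \<in> paths Q' \<and> q \<in> paths Q' \<and> p @ q \<in> walks a c \<longleftrightarrow>
    p \<in> walks a (target p) \<and> q \<in> walks (target p) c"
proof
  assume asm: "p \<in> paths Q' \<and> q \<in> paths Q' \<and> p @ q \<in> walks a c"
  then have ne: "p \<noteq> []" "q \<noteq> []" by (simp_all add: paths_def)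
  from asm have "Q'.awalk a (p @ q) c" by (simp add: walks_def)
  then have pq: "Q'.awalk a p (Q'.awlast a p)" "Q'.awalk (Q'.awlast a p) q c"
    unfolding Q'.awalk_append_iff by blast+
  have "Q'.awlast a p = target p"
    using Q'.awalk_ends_hd_last[OF pq(1) ne(1)] by (simp add: target_def)
  then show "p \<in> walks a (target p) \<and> q \<in> walks (target p) c"
    using pq ne by (simp add: walks_def)
next
  assume asm: "p \<in> walks a (target p) \<and> q \<in> walks (target p) c"
  then have "Q'.awalk a (p @ q) c" unfolding walks_def by (blast intro: Q'.awalk_appendI)
  moreover have "p \<in> paths Q'" "q \<in> paths Q'" using asm unfolding walks_iff by blast+
  ultimately show "p \<in> paths Q' \<and> q \<in> paths Q' \<and> p @ q \<in> walks a c"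
    by (simp add: walks_def paths_def)
qed

text \<open>Walking in \<open>Q\<close> makes sure that \<open>rep a b\<close> is never an extra arrow.\<close>

definition rep :: "'v \<Rightarrow> 'v \<Rightarrow> 'e list" where
  "rep a b = (SOME p. Q.awalk a p b \<and> p \<noteq> [])"

lemma rep_walk:
  assumes "(a, b) \<in> R"
  shows "Q.awalk a (rep a b) b" "rep a b \<in> walks a b"
proof -
  have "\<exists>p. Q.awalk a p b \<and> p \<noteq> []" using assms by (simp add: Q.awalk_arc_order)
  then have *: "Q.awalk a (rep a b) b \<and> rep a b \<noteq> []" unfolding rep_def by (rule someI_ex)
  then show "Q.awalk a (rep a b) b" by blast
  show "rep a b \<in> walks a b"
    using * Q'.subgraph_awalk_imp_awalk[OF _ subgraph_Q] by (auto simp: walks_def)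
qed

text \<open>A long path has an inner vertex, which a parallel arrow would bypass. Hence the
  generators of the ideal concern either all walks from \<open>a\<close> to \<open>b\<close> or none
  of them.\<close>

lemma long_walks:
  assumes p: "p \<in> walks a b" "length p \<ge> 2" and q: "q \<in> walks a b"
  shows "length q \<ge> 2"
proof (rule ccontr)
  assume "\<not> 2 \<le> length q"
  moreover have "q \<noteq> []" using q by (simp add: walks_def)
  ultimately obtain e where e: "q = [e]" by (cases q) (auto simp: Suc_le_eq)
  then have "(a, b) \<in> arcs_ends Q'" using q by (auto simp: walks_def Q'.awalk_simps arcs_ends_conv)
  obtain f p' where pf: "p = f # p'" using p(2) by (cases p) auto
  have p': "p' \<noteq> []" using p(2) pf by auto
  have f: "f \<in> arcs Q'" "Q'.awalk (head Q' f) p' b" "tail Q' f = a"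
    using p(1) pf by (auto simp: walks_def Q'.awalk_simps)
  have "(a, head Q' f) \<in> arcs_ends Q'" using f by (auto simp: arcs_ends_conv)
  then have "(a, head Q' f) \<in> R" unfolding arcs_ends_eq arc_order_def by (rule r_into_trancl)
  moreover have "(head Q' f, b) \<in> R"
    unfolding arc_order_eq[symmetric] Q'.awalk_arc_order using f p' by blast
  ultimately show False using no_bypass \<open>(a, b) \<in> arcs_ends Q'\<close> arcs_ends_eq by blast
qed

section \<open>Coordinates of the path algebra modulo parallel long paths\<close>

abbreviation A :: "(real, 'e list \<Rightarrow> real) module" where "A \<equiv> path_algebra Q'"

sublocale A: coordinatized A "paths Q'" "\<lambda>x. x"
  by (rule coordinatized_path_algebra[OF finite_paths_Q'])

lemma carrier_A: "x \<in> carrier A \<longleftrightarrow> (\<forall>p. p \<notin> paths Q' \<longrightarrow> x p = 0)"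
proof -
  have "finite {p. x p \<noteq> 0}" if "{p. x p \<noteq> 0} \<subseteq> paths Q'"
    using that finite_paths_Q' by (rule finite_subset)
  then show ?thesis unfolding path_algebra_simps(1) by blast
qed

text \<open>Parallel paths are summed and scaled by the length of their class. Original and extra
  arrows enter the same sum, so the element dual to \<open>Inr e\<close> is \<open>e\<close> minus
  the original arrow parallel to it.\<close>

fun coord :: "('e list \<Rightarrow> real) \<Rightarrow> ('v \<times> 'v) + 'e \<Rightarrow> real" where
  "coord x (Inl (a, b)) = sqrt (weight a) * (\<Sum>p\<in>walks a b. x p)"
| "coord x (Inr e) = (if e \<in> E then x [e] else 0)"

lemma weight_pos_fst: "(a, b) \<in> R \<Longrightarrow> weight a > 0"
  by (rule weight_pos) (auto simp: Field_def)

lemma coord_mult_A: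
  assumes "x \<in> carrier A" "y \<in> carrier A"
  shows "coord (x \<otimes>\<^bsub>A\<^esub> y) k = path_mult (coord x) (coord y) k"
proof (cases k)
  case (Inl ac)
  then obtain a c where k: "k = Inl (a, c)" by (cases ac) auto
  let ?S = "\<lambda>r. {(p, q). p \<in> paths Q' \<and> q \<in> paths Q' \<and> p @ q = r}"
  let ?F = "\<lambda>p q. x p * y q"
  have fin_S: "finite (?S r)" for r
    by (rule finite_subset[of _ "paths Q' \<times> paths Q'"]) (use finite_paths_Q' in auto)
  have "(\<Sum>r\<in>walks a c. (x \<otimes>\<^bsub>A\<^esub> y) r) = (\<Sum>r\<in>walks a c. \<Sum>(p, q)\<in>?S r. ?F p q)"
    by (intro sum.cong refl) (simp add: path_algebra_simps walks_iff)
  also have "\<dots> = (\<Sum>(r, p, q)\<in>Sigma (walks a c) ?S. ?F p q)"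
    by (subst sum.Sigma) (use fin_S in \<open>auto simp: case_prod_beta\<close>)
  \<comment> \<open>Cutting a path from \<open>a\<close> to \<open>c\<close> into two nonempty
    pieces amounts to choosing the inner vertex where the first piece ends and a walk on either
    side.\<close>
  also have "\<dots> = (\<Sum>(b, p, q)\<in>Sigma (between a c) (\<lambda>b. walks a b \<times> walks b c). ?F p q)"
  proof (rule sum.reindex_bij_witness[of _ "\<lambda>(b, p, q). (p @ q, p, q)" "\<lambda>(r, p, q). (target p, p, q)"])
    fix z assume "z \<in> Sigma (walks a c) ?S"
    then obtain p q where z: "z = (p @ q, p, q)" "p \<in> paths Q'" "q \<in> paths Q'" "p @ q \<in> walks a c"
      by auto
    then have pq: "p \<in> walks a (target p)" "q \<in> walks (target p) c" using append_walks by blast+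
    then have "target p \<in> between a c" unfolding R_iff_walks by blast
    then show "(\<lambda>(r, p, q). (target p, p, q)) z \<in> Sigma (between a c) (\<lambda>b. walks a b \<times> walks b c)"
      using pq z by simp
  next
    fix z assume "z \<in> Sigma (between a c) (\<lambda>b. walks a b \<times> walks b c)"
    then obtain b p q where z: "z = (b, p, q)" "p \<in> walks a b" "q \<in> walks b c" by auto
    moreover from this have "target p = b" by (simp add: walks_iff)
    ultimately show "(\<lambda>(b, p, q). (p @ q, p, q)) z \<in> Sigma (walks a c) ?S"
      "(\<lambda>(r, p, q). (target p, p, q)) ((\<lambda>(b, p, q). (p @ q, p, q)) z) = z"
      using append_walks[of p q a c] by auto
  qed auto
  also have "\<dots> = (\<Sum>b\<in>between a c. \<Sum>(p, q)\<in>walks a b \<times> walks b c. ?F p q)"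
    by (subst sum.Sigma) (auto simp: case_prod_beta)
  also have "\<dots> = (\<Sum>b\<in>between a c. (\<Sum>p\<in>walks a b. x p) * (\<Sum>q\<in>walks b c. y q))"
    by (simp add: sum_product sum.cartesian_product)
  finally have sum: "(\<Sum>r\<in>walks a c. (x \<otimes>\<^bsub>A\<^esub> y) r) =
    (\<Sum>b\<in>between a c. (\<Sum>p\<in>walks a b. x p) * (\<Sum>q\<in>walks b c. y q))" .
  \<comment> \<open>\<open>middle b\<close> cancels the scaling of the second factor, which starts
    at \<open>b\<close>.\<close>
  have mid: "middle b * coord x (Inl (a, b)) * coord y (Inl (b, c)) =
      sqrt (weight a) * ((\<Sum>p\<in>walks a b. x p) * (\<Sum>q\<in>walks b c. y q))" if "b \<in> between a c" for b
  proof -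
    have "weight b > 0" using that weight_pos_fst by blast
    then show ?thesis by (simp add: middle_def)
  qed
  have "coord (x \<otimes>\<^bsub>A\<^esub> y) k =
      sqrt (weight a) * (\<Sum>b\<in>between a c. (\<Sum>p\<in>walks a b. x p) * (\<Sum>q\<in>walks b c. y q))"
    by (simp only: k coord.simps sum)
  also have "\<dots> = (\<Sum>b\<in>between a c.
      sqrt (weight a) * ((\<Sum>p\<in>walks a b. x p) * (\<Sum>q\<in>walks b c. y q)))"
    by (rule sum_distrib_left)
  also have "\<dots> = (\<Sum>b\<in>between a c. middle b * coord x (Inl (a, b)) * coord y (Inl (b, c)))"
    by (intro sum.cong refl mid[symmetric])
  also have "\<dots> = path_mult (coord x) (coord y) k" by (simp only: k path_mult.simps)
  finally show ?thesis .
next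
  case (Inr e)
  have empty: "{(p, q). p \<in> paths Q' \<and> q \<in> paths Q' \<and> p @ q = [e]} = {}"
    by (auto simp: paths_def append_eq_Cons_conv)
  have "(x \<otimes>\<^bsub>A\<^esub> y) [e] = 0" unfolding path_algebra_simps(5) empty by simp
  then show ?thesis unfolding Inr by simp
qed

text \<open>Extra arrows receive their prescribed coefficients through \<open>g\<close>; then the
  representative of each class absorbs through \<open>h\<close> what its sum still lacks.\<close>

lemma coord_surj:
  assumes f: "\<And>i. i \<notin> R <+> E \<Longrightarrow> f i = 0"
  obtains x where "x \<in> carrier A" "coord x = f"
proof -
  define g where "g p = (if \<exists>e\<in>E. p = [e] then f (Inr (hd p)) else 0)" for p
  define h where "h a b = f (Inl (a, b)) / sqrt (weight a) - sum g (walks a b)" for a b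
  define x where "x p = (if p \<in> paths Q' then
    g p + (if p = rep (source p) (target p) then h (source p) (target p) else 0) else 0)" for p
  have "coord x i = f i" for i
  proof (cases i)
    case (Inl ab)
    then obtain a b where i: "i = Inl (a, b)" by (cases ab) auto
    show ?thesis
    proof (cases "(a, b) \<in> R")
      case True
      have "sum x (walks a b) = (\<Sum>p\<in>walks a b. g p + (if p = rep a b then h a b else 0))"
        by (intro sum.cong refl) (auto simp: x_def walks_iff)
      also have "\<dots> = f (Inl (a, b)) / sqrt (weight a)"
        using rep_walk[OF True] by (simp add: sum.distrib h_def)
      finally show ?thesis unfolding i using weight_pos_fst[OF True] by simp
    next
      case False
      then have "walks a b = {}" by (simp add: R_iff_walks)
      moreover have "f i = 0" using False i by (intro f) auto
      ultimately show ?thesis unfolding i by simp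
    qed
  next
    case (Inr e)
    show ?thesis
    proof (cases "e \<in> E")
      case True
      then have "[e] \<in> paths Q'" by (intro Q'.arc_in_paths) simp
      \<comment> \<open>A representative is a walk in \<open>Q\<close>, so the correction
        \<open>h\<close> never touches an extra arrow.\<close>
      moreover have "[e] \<noteq> rep (source [e]) (target [e])"
        using rep_walk(1)[OF path_ends_R[OF calculation]] True by (auto simp: Q.awalk_simps dest: sym)
      ultimately show ?thesis unfolding Inr using True by (simp add: x_def g_def)
    next
      case False
      then have "f (Inr e) = 0" by (intro f) auto
      then show ?thesis unfolding Inr coord.simps using False by auto
    qed
  qed
  moreover have "x \<in> carrier A" by (simp add: carrier_A x_def)
  ultimately show thesis using that by blast
qed

sublocale coords: algebra_coordinates A "R <+> E" coord path_mult
proof (rule algebra_coordinates.intro)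
  show "finite (R <+> E)" by (simp add: finite_R)
  show "coord ` carrier A = {f. \<forall>i. i \<notin> R <+> E \<longrightarrow> f i = 0}"
  proof
    show "coord ` carrier A \<subseteq> {f. \<forall>i. i \<notin> R <+> E \<longrightarrow> f i = 0}"
    proof (clarify)
      fix x and i :: "('v \<times> 'v) + 'e" assume i: "i \<notin> R <+> E"
      show "coord x i = 0"
      proof (cases i)
        case (Inl ab)
        then obtain a b where ab: "i = Inl (a, b)" by (cases ab) auto
        then have "(a, b) \<notin> R" using i by auto
        then show ?thesis using ab R_iff_walks by simp
      qed (use i in auto)
    qed
    show "{f. \<forall>i. i \<notin> R <+> E \<longrightarrow> f i = 0} \<subseteq> coord ` carrier A"
    proof
      fix f :: "('v \<times> 'v) + 'e \<Rightarrow> real" assume "f \<in> {f. \<forall>i. i \<notin> R <+> E \<longrightarrow> f i = 0}"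
      then obtain x where "x \<in> carrier A" "coord x = f" using coord_surj[of f] by blast
      then show "f \<in> coord ` carrier A" by blast
    qed
  qed
  fix x y assume xy: "x \<in> carrier A" "y \<in> carrier A"
  show "coord (x \<oplus>\<^bsub>A\<^esub> y) = (\<lambda>i. coord x i + coord y i)"
  proof
    fix i show "coord (x \<oplus>\<^bsub>A\<^esub> y) i = coord x i + coord y i"
      by (cases "(x, i)" rule: coord.cases) (auto simp: path_algebra_simps sum.distrib algebra_simps)
  qed
  show "x \<otimes>\<^bsub>A\<^esub> y \<in> carrier A" unfolding carrier_A by (simp add: path_algebra_simps(5))
  show "coord (x \<otimes>\<^bsub>A\<^esub> y) = path_mult (coord x) (coord y)"
    using coord_mult_A[OF xy] by blast
next
  fix x c assume "x \<in> carrier A"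
  show "coord (c \<odot>\<^bsub>A\<^esub> x) = (\<lambda>i. c * coord x i)"
  proof
    fix i show "coord (c \<odot>\<^bsub>A\<^esub> x) i = c * coord x i"
      by (cases "(x, i)" rule: coord.cases) (auto simp: path_algebra_simps sum_distrib_left algebra_simps)
  qed
qed (rule A.vectorspace)

text \<open>An extra arrow has a coordinate of its own. All other walks parallel to an original
  arrow are extra arrows, so the sum over its class reduces to its own coefficient.\<close>

lemma kernel_short_path:
  assumes x: "x \<in> coords.kernel" and q: "q \<in> paths Q'" "length q < 2"
  shows "x q = 0"
proof -
  have cx: "coord x i = 0" for i using x by (simp add: coords.kernel_def)
  have "q \<noteq> []" using q by (simp add: paths_def)
  then obtain e where e: "q = [e]" using q(2) by (cases q) (auto simp: less_Suc_eq)
  show ?thesis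
  proof (cases "e \<in> E")
    case True
    then show ?thesis using cx[of "Inr e"] e by simp
  next
    case False
    define a where "a = source q"
    define b where "b = target q"
    have qw: "q \<in> walks a b" using q by (simp add: walks_iff a_def b_def)
    then have eQ: "e \<in> arcs Q" "tail Q e = a" "head Q e = b"
      using False e ends_eq by (auto simp: walks_def Q'.awalk_simps)
    have "x p = 0" if p: "p \<in> walks a b - {q}" for p
    proof -
      have "length p < 2" using long_walks[OF _ _ qw, of p] p q(2) by force
      moreover have "p \<noteq> []" using p by (simp add: walks_def)
      ultimately obtain e' where e': "p = [e']" by (cases p) (auto simp: less_Suc_eq)
      then have e'': "e' \<in> arcs Q'" "tail Q e' = a" "head Q e' = b" "e' \<noteq> e"
        using p e ends_eq by (auto simp: walks_def Q'.awalk_simps)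
      then have "e' \<notin> arcs Q" using Q.no_multi_arcs[of e e'] eQ by (auto simp: arc_to_ends_def)
      then show ?thesis using cx[of "Inr e'"] e' e'' by simp
    qed
    then have "(\<Sum>p\<in>walks a b. x p) = x q"
      using qw by (simp add: sum.remove)
    moreover have "weight a > 0" using qw R_iff_walks weight_pos_fst by blast
    ultimately show ?thesis using cx[of "Inl (a, b)"] by simp
  qed
qed

text \<open>A kernel element is the combination, with its own coefficients, of the differences of
  long paths and their representatives, because its coefficients sum to zero over each
  class.\<close>

lemma kernel_subset_ideal:
  assumes J: "algebra_ideal A J"
    and gens: "\<And>p q a b. p \<in> walks a b \<Longrightarrow> q \<in> walks a b \<Longrightarrow> length p \<ge> 2 \<Longrightarrow> length q \<ge> 2 \<Longrightarrow>
      path_vector p \<ominus>\<^bsub>A\<^esub> path_vector q \<in> J"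
  shows "coords.kernel \<subseteq> J"
proof
  fix x assume x: "x \<in> coords.kernel"
  have sub: "Module.submodule J class_ring A" using J by (simp add: algebra_ideal_def)
  let ?rep = "\<lambda>p. rep (source p) (target p)"
  let ?d = "\<lambda>p. path_vector p \<ominus>\<^bsub>A\<^esub> path_vector (?rep p)"
  define long where "long = {p \<in> paths Q'. length p \<ge> 2}"
  have rep_long: "?rep p \<in> walks (source p) (target p)" "p \<in> walks (source p) (target p)"
    "length (?rep p) \<ge> 2" if "p \<in> long" for p
  proof -
    have p: "p \<in> paths Q'" "length p \<ge> 2" using that by (simp_all add: long_def)
    show 1: "?rep p \<in> walks (source p) (target p)"
      by (rule rep_walk(2)[OF path_ends_R[OF p(1)]])
    show 2: "p \<in> walks (source p) (target p)" using p by (simp add: walks_iff)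
    show "length (?rep p) \<ge> 2" by (rule long_walks[OF 2 p(2) 1])
  qed
  have d_in: "?d p \<in> J" if "p \<in> long" for p
  proof (rule gens[OF rep_long(2)[OF that] rep_long(1)[OF that] _ rep_long(3)[OF that]])
    show "length p \<ge> 2" using that by (simp add: long_def)
  qed
  have d_eq: "?d p q = (if q = p then 1 else 0) - (if q = ?rep p then 1 else 0)" if "p \<in> long" for p q
  proof -
    have "p \<in> paths Q'" "?rep p \<in> paths Q'" using rep_long[OF that] by (auto simp: walks_iff)
    then show ?thesis using A.coord_minus(2)[OF path_vector_closed path_vector_closed]
      by (simp add: path_vector_def)
  qed
  have fin: "finite long" using finite_paths_Q' by (simp add: long_def)
  have "(\<lambda>q. \<Sum>p\<in>F. x p * ?d p q) \<in> J" if "finite F" "F \<subseteq> long" for F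
    using that
  proof (induction F rule: finite_induct)
    case empty
    have "\<zero>\<^bsub>A\<^esub> \<in> J" using Module.submodule.axioms(1)[OF sub] subgroup.one_closed by fastforce
    then show ?case by (simp add: path_algebra_simps)
  next
    case (insert p F)
    have "x p \<odot>\<^bsub>A\<^esub> ?d p \<in> J"
      using Module.submodule.smult_closed[OF sub] d_in insert.prems by auto
    moreover have "(\<lambda>q. \<Sum>p\<in>F. x p * ?d p q) \<in> J" using insert by auto
    ultimately have "x p \<odot>\<^bsub>A\<^esub> ?d p \<oplus>\<^bsub>A\<^esub> (\<lambda>q. \<Sum>p\<in>F. x p * ?d p q) \<in> J"
      using subgroup.m_closed[OF Module.submodule.axioms(1)[OF sub]] by fastforce
    then show ?case using insert by (simp add: path_algebra_simps)
  qed
  from this[OF fin subset_refl] have in_J: "(\<lambda>q. \<Sum>p\<in>long. x p * ?d p q) \<in> J" .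
  have "(\<Sum>p\<in>long. x p * ?d p q) = x q" for q
  proof -
    have "(\<Sum>p\<in>long. x p * ?d p q) =
        (\<Sum>p\<in>long. (if q = p then x p else 0) - (if q = ?rep p then x p else 0))"
      by (intro sum.cong refl) (simp add: d_eq)
    also have "\<dots> = (\<Sum>p\<in>long. if q = p then x p else 0) - (\<Sum>p\<in>long. if q = ?rep p then x p else 0)"
      by (rule sum_subtractf)
    also have "(\<Sum>p\<in>long. if q = p then x p else 0) = (if q \<in> long then x q else 0)"
      using fin by simp
    \<comment> \<open>If \<open>q\<close> is a representative, the paths it represents form a full
      class of parallel walks, over which the coefficients of \<open>x\<close> sum to zero.\<close>
    also have "(\<Sum>p\<in>long. if q = ?rep p then x p else 0) = 0"
    proof (cases "\<exists>p\<in>long. q = ?rep p")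
      case True
      then obtain p0 where p0: "p0 \<in> long" "q = ?rep p0" by blast
      let ?a = "source p0" and ?b = "target p0"
      have "q = ?rep p \<longleftrightarrow> p \<in> walks ?a ?b" if "p \<in> long" for p
      proof
        assume q: "q = ?rep p"
        have "q \<in> walks (source p) (target p)" unfolding q by (rule rep_long(1)[OF that])
        moreover have "q \<in> walks ?a ?b" unfolding p0(2) by (rule rep_long(1)[OF p0(1)])
        ultimately have "source p = ?a" "target p = ?b" unfolding walks_iff by auto
        then show "p \<in> walks ?a ?b" using rep_long(2)[OF that] by simp
      next
        assume "p \<in> walks ?a ?b"
        then show "q = ?rep p" unfolding p0(2) walks_iff by simp
      qed
      then have "(\<Sum>p\<in>long. if q = ?rep p then x p else 0) = (\<Sum>p\<in>long. if p \<in> walks ?a ?b then x p else 0)"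
        by (intro sum.cong refl) simp
      also have "\<dots> = sum x (walks ?a ?b)"
      proof -
        have "walks ?a ?b \<subseteq> long"
        proof
          fix p assume p: "p \<in> walks ?a ?b"
          have "length p0 \<ge> 2" using p0(1) by (simp add: long_def)
          then have "length p \<ge> 2" by (rule long_walks[OF rep_long(2)[OF p0(1)] _ p])
          then show "p \<in> long" using p by (simp add: long_def walks_iff)
        qed
        then have "long \<inter> walks ?a ?b = walks ?a ?b" by blast
        then show ?thesis using sum.inter_restrict[OF fin, of x "walks ?a ?b"] by simp
      qed
      also have "\<dots> = 0"
      proof -
        have "(?a, ?b) \<in> R" using p0 path_ends_R by (simp add: long_def)
        then have "weight ?a > 0" by (rule weight_pos_fst)
        moreover have "coord x (Inl (?a, ?b)) = 0" using x by (simp add: coords.kernel_def)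
        ultimately show ?thesis by simp
      qed
      finally show ?thesis .
    qed (auto intro: sum.neutral)
    also have "(if q \<in> long then x q else 0) - 0 = x q"
    proof -
      have "x q = 0" if "q \<notin> paths Q'"
        using x that unfolding coords.kernel_def carrier_A by blast
      then show ?thesis
        using kernel_short_path[OF x, of q] by (cases "q \<in> paths Q'") (auto simp: long_def)
    qed
    finally show ?thesis .
  qed
  then show "x \<in> J" using in_J by simp
qed

text \<open>The kernel is an ideal, contains the generators since parallel long paths have equal
  coordinates, and is the least such ideal by \<open>kernel_subset_ideal\<close>.\<close>

lemma parallel_path_ideal_eq: "parallel_path_ideal Q' = coords.kernel"
proof -
  let ?gens = "{path_vector w1 \<ominus>\<^bsub>A\<^esub> path_vector w2 | w1 w2 u v.
          Q'.awalk u w1 v \<and> Q'.awalk u w2 v \<and> length w1 \<ge> 2 \<and> length w2 \<ge> 2}"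
  have "algebra_ideal A coords.kernel"
    by (rule coords.kernel_algebra_ideal; rule ext; case_tac i rule: sum.exhaust) auto
  moreover have "?gens \<subseteq> coords.kernel"
  proof clarify
    fix w1 w2 u v
    assume w: "Q'.awalk u w1 v" "Q'.awalk u w2 v" "length w1 \<ge> 2" "length w2 \<ge> 2"
    then have ww: "w1 \<in> walks u v" "w2 \<in> walks u v" by (auto simp: walks_def)
    then have car: "path_vector w1 \<in> carrier A" "path_vector w2 \<in> carrier A"
      by (auto intro!: path_vector_closed simp: walks_iff)
    have "coord (path_vector w) (Inl (a, b)) = (if w \<in> walks a b then sqrt (weight a) else 0)" for w a b
      by (simp add: path_vector_def sum.delta)
    moreover have "w1 \<in> walks a b \<longleftrightarrow> w2 \<in> walks a b" for a b using ww by (auto simp: walks_iff)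
    moreover have "coord (path_vector w1) (Inr e) = 0" "coord (path_vector w2) (Inr e) = 0" for e
      using w by (auto simp: path_vector_def)
    ultimately have "coord (path_vector w1) i = coord (path_vector w2) i" for i
      by (cases i) auto
    then show "path_vector w1 \<ominus>\<^bsub>A\<^esub> path_vector w2 \<in> coords.kernel"
      using car A.coord_minus(1)[OF car] by (simp add: coords.kernel_def coords.coord_minus)
  qed
  moreover have "coords.kernel \<subseteq> J" if "algebra_ideal A J" "?gens \<subseteq> J" for J
  proof (rule kernel_subset_ideal[OF that(1)])
    fix p q a b
    assume "p \<in> walks a b" "q \<in> walks a b" "length p \<ge> 2" "length q \<ge> 2"
    then have "path_vector p \<ominus>\<^bsub>A\<^esub> path_vector q \<in> ?gens" unfolding walks_def by blast
    then show "path_vector p \<ominus>\<^bsub>A\<^esub> path_vector q \<in> J" using that(2) by blast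
  qed
  ultimately show ?thesis
    unfolding parallel_path_ideal_def by (intro hull_unique) simp_all
qed

theorem algebraic_ricci_soliton_quotient:
  "\<exists>ip. algebraic_ricci_soliton
    (commutator_lie_algebra (quotient_algebra A (parallel_path_ideal Q'))) ip (-1)"
proof -
  interpret L: coordinatized_lie_algebra coords.Lie "R <+> E" coords.class_coord lie_const
  proof (rule coords.coordinatized_lie_algebra_quotient)
    show "path_mult (path_mult f g) h = path_mult f (path_mult g h)"
      for f g h :: "('v \<times> 'v) + 'e \<Rightarrow> real" by (rule ext) (rule path_mult_assoc)
    show "path_mult f g k - path_mult g f k = (\<Sum>i\<in>R <+> E. \<Sum>j\<in>R <+> E. lie_const i j k * f i * g j)"
      if "k \<in> R <+> E" for f g k
      using that by (intro path_mult_lie_const) auto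
    show "path_mult (\<lambda>i. f i - g i) h = (\<lambda>i. path_mult f h i - path_mult g h i)"
      "path_mult h (\<lambda>i. f i - g i) = (\<lambda>i. path_mult h f i - path_mult h g i)"
      for f g h :: "('v \<times> 'v) + 'e \<Rightarrow> real" by (rule ext, rule path_mult_diff)+
    show "lie_const i j k = - lie_const j i k" for i j k by (simp add: lie_const_def)
  qed
  have "algebraic_ricci_soliton coords.Lie L.coord_ip (-1)"
  proof (rule L.algebraic_ricci_solitonI[where d = degree])
    fix i j k m assume ijk: "i \<in> R <+> E" "j \<in> R <+> E"
    show "lie_const i j j = 0" by (rule lie_const_trace) (rule ijk)
    show "degree k = degree i + degree j" if "lie_const i j k \<noteq> 0"
      by (rule degree_additive) (use ijk that in auto)
    show "lie_const i j k * lie_const m k j = 0" if "k \<in> R <+> E" "m \<in> R <+> E"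
      by (rule lie_const_killing) (use ijk that in auto)
  next
    fix i m assume "i \<in> R <+> E" "m \<in> R <+> E"
    then show "(\<Sum>j\<in>R <+> E. \<Sum>p\<in>R <+> E. lie_const j p i * lie_const j p m) / 4 -
        (\<Sum>j\<in>R <+> E. \<Sum>p\<in>R <+> E. lie_const i j p * lie_const m j p) / 2 =
        (if i = m then - 1 + degree m else 0)"
      by (intro lie_const_ricci) auto
  qed
  then show ?thesis unfolding parallel_path_ideal_eq by blast
qed

end

section \<open>Hasse quivers built from arrays\<close>

theorem theorem5p7:
  fixes P :: "'v set" and r :: "'v \<Rightarrow> 'v \<Rightarrow> bool"
    and Q Q' :: "('v, 'e) pre_digraph"
  assumes "finite P" and "taos P r" and "hasse_quiver P r Q"
    and "(\<exists>P' r'. array_taos P' r' \<and> hasse_quiver P' r' Q) \<or>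
      (\<exists>Es. algebraically_connected_components Q Es \<and>
        (\<forall>E\<in>Es. \<exists>P' r'. array_taos P' r' \<and> hasse_quiver P' r' E) \<and>
        (\<forall>E\<in>Es. \<forall>F\<in>Es. E \<noteq> F \<longrightarrow>
          \<not> (\<exists>u v p q. pre_digraph.awalk E u p v \<and> length p \<ge> 2 \<and>
               pre_digraph.awalk F u q v \<and> length q \<ge> 2)))"
    and "fin_digraph Q'" and "spanning Q Q'"
    and "\<forall>e\<in>arcs Q' - arcs Q. \<exists>f\<in>arcs Q. tail Q' e = tail Q f \<and> head Q' e = head Q f"
  shows "\<exists>ip. algebraic_ricci_soliton
    (commutator_lie_algebra (quotient_algebra (path_algebra Q') (parallel_path_ideal Q'))) ip (-1)"
proof -
  have nomulti: "nomulti_digraph Q" using assms(3) by (simp add: hasse_quiver_def)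
  then interpret Q: nomulti_digraph Q .
  interpret Q': fin_digraph Q' by fact
  have acyc: "acyclic (arcs_ends Q)" by (rule hasse_quiver_acyclic) fact+
  have sub: "verts Q \<subseteq> verts Q'" "arcs Q \<subseteq> arcs Q'"
    using assms(6) by (auto simp: spanning_def subgraph_def)
  have "fin_digraph Q"
  proof unfold_locales
    show "finite (verts Q)" using sub(1) Q'.finite_verts by (rule finite_subset)
    show "finite (arcs Q)" using sub(2) Q'.finite_arcs by (rule finite_subset)
  qed
  then have fin: "finite (paths Q)" using acyc by (rule finite_paths)
  \<comment> \<open>The two alternatives enter through layeredness; acyclicity and the absence of
    bypasses come from \<open>Q\<close> being the Hasse quiver of \<open>P\<close>.\<close>
  have "layered (arc_order Q)"
    using assms(4)
  proof
    assume "\<exists>P' r'. array_taos P' r' \<and> hasse_quiver P' r' Q"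
    then show ?thesis by (elim exE conjE) (rule array_taos_layered)
  next
    assume "\<exists>Es. algebraically_connected_components Q Es \<and>
        (\<forall>E\<in>Es. \<exists>P' r'. array_taos P' r' \<and> hasse_quiver P' r' E) \<and>
        (\<forall>E\<in>Es. \<forall>F\<in>Es. E \<noteq> F \<longrightarrow>
          \<not> (\<exists>u v p q. pre_digraph.awalk E u p v \<and> length p \<ge> 2 \<and>
               pre_digraph.awalk F u q v \<and> length q \<ge> 2))"
    then obtain Es where *: "algebraically_connected_components Q Es \<and>
        (\<forall>E\<in>Es. \<exists>P' r'. array_taos P' r' \<and> hasse_quiver P' r' E) \<and>
        (\<forall>E\<in>Es. \<forall>F\<in>Es. E \<noteq> F \<longrightarrow>
          \<not> (\<exists>u v p q. pre_digraph.awalk E u p v \<and> length p \<ge> 2 \<and>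
               pre_digraph.awalk F u q v \<and> length q \<ge> 2))" ..
    note Es = *[THEN conjunct1] *[THEN conjunct2, THEN conjunct1] *[THEN conjunct2, THEN conjunct2]
    have "layered (arc_order E)" if "E \<in> Es" for E
    proof -
      obtain P' r' where "array_taos P' r'" "hasse_quiver P' r' E" using Es(2) \<open>E \<in> Es\<close> by blast
      then show ?thesis by (rule array_taos_layered)
    qed
    then show ?thesis
      by (rule components_layered[OF Es(1) Q.wf_digraph_axioms fin _ Es(3)])
  qed
  with assms(5,6) nomulti acyc assms(7) hasse_quiver_no_bypass[OF assms(2,3)]
  have "thickened_quiver Q Q'" by (rule thickened_quiver.intro)
  then show ?thesis by (rule thickened_quiver.algebraic_ricci_soliton_quotient)
qed

end
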